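(* Assume (A1)--(A5) (listed in the context) for the baseline $P$ and the constraint set $E$, and let $\varepsilon_N\downarrow 0$ with $N\varepsilon_N>c_{\mathrm{rnd}}$ for all sufficiently large $N$. Then there is a constant $C(P,E)<\infty$ such that, for all sufficiently large $N$, every $m$-element index set $I_N\subseteq\{1,\dots,N\}$, and every $\delta>0$, $$\big\|L_{N,I_N,P}-(P^\star)^{\otimes m}\big\|_{\mathrm{TV}}\le m\delta+\frac{m(m-1)}{2N}+C(P,E)\,(N+1)^{2k}e^{-2N\delta^2}+C_0\,m\,\varepsilon_N ,$$ where $C_0$ is the constant in (A5).
   Context: Let $\mathcal X=\{1,\dots,k\}$, let $\Delta(\mathcal X)$ be the probability simplex, $\|P-Q\|_{\mathrm{TV}}=\tfrac12\sum_x|P(x)-Q(x)|$, $D(Q\|P)=\sum_xQ(x)\log\{Q(x)/P(x)\}$, $\langle g,Q\rangle=\sum_x g(x)Q(x)$. Let $r\ge 1$, $0\le r_0\le r$, $g_1,\dots,g_r:\mathcal X\to\mathbb R$, $\alpha_1,\dots,\alpha_r\in\mathbb R$, and $$E=\{Q\in\Delta(\mathcal X):\langle g_j,Q\rangle=\alpha_j\ (j\le r_0),\ \langle g_j,Q\rangle\ge\alpha_j\ (r_0<j\le r)\},$$ $$E_\varepsilon=\{Q\in\Delta(\mathcal X):|\langle g_j,Q\rangle-\alpha_j|\le\varepsilon\ (j\le r_0),\ \langle g_j,Q\rangle\ge\alpha_j-\varepsilon\ (r_0<j\le r)\}\quad(\varepsilon\ge0).$$ Put $c_{\mathrm{rnd}}=k\max_j\|g_j\|_\infty$.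 For $P\in\Delta(\mathcal X)$ let $P^\star=\arg\min_{Q\in E}D(Q\|P)$ and $P^\star_\varepsilon=\arg\min_{Q\in E_\varepsilon}D(Q\|P)$ (the $I$-projections of $P$). Assumptions: (A1) $k<\infty$. (A2) $\min_xP(x)>0$. (A3) $E$ is nonempty (closed and convex). (A4) $\min_xP^\star(x)>0$. (A5) For some $C_0<\infty$, $\|P^\star_\varepsilon-P^\star_{\varepsilon'}\|_{\mathrm{TV}}\le C_0|\varepsilon-\varepsilon'|$ whenever $\varepsilon,\varepsilon'\ge0$ are sufficiently small. $X_1,\dots,X_N$ are i.i.d. $P$ under $\mathbb P_P$, $\widehat P_N=\frac1N\sum_{i=1}^N\delta_{X_i}$, $E_N=\{\widehat P_N\in E_{\varepsilon_N}\}$, and for an $m$-element set $I_N\subseteq\{1,\dots,N\}$, $L_{N,I_N,P}$ is the conditional law of $X_{I_N}=(X_i)_{i\in I_N}$ under $\mathbb P_P$ given $E_N$. $C(P,E)$ denotes a finite constant depending only on $P$ and the data $(g_j,\alpha_j,r_0,r)$ defining $E$ and its windows, not on $N,m,I_N,\delta$. *)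

theory Defs
  imports "HOL-Probability.Probability"
begin

text \<open>
  The alphabet is a finite type \<open>'a\<close> with \<open>k = CARD('a)\<close>, and the probability
  simplex over it is the type \<open>'a pmf\<close>. The constraints are \<open>g j\<close>, \<open>\<alpha> j\<close> for
  \<open>j \<in> {1..r}\<close>; the first \<open>r0\<close> of them are equalities. All values of \<open>g\<close> and \<open>\<alpha>\<close>
  at other indices are irrelevant.
\<close>

text \<open>The type is not required to be finite: the distance is also used for laws on
  \<open>nat \<Rightarrow> 'a\<close>. The family is always absolutely summable, and \<open>infsum\<close> is the plain
  finite sum when the type is finite.\<close>
definition tv_dist :: "'b pmf \<Rightarrow> 'b pmf \<Rightarrow> real" where
  "tv_dist p q = (1/2) * (\<Sum>\<^sub>\<infinity>x. \<bar>pmf p x - pmf q x\<bar>)"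

text \<open>Faithful for a reference law \<open>P\<close> of full support (the only case used); then
  \<open>ln 0 = 0\<close> gives the convention \<open>0 log 0 = 0\<close>. For \<open>pmf P x = 0 < pmf Q x\<close> the
  value is not \<open>\<infinity>\<close>.\<close>
definition rel_entropy :: "'a::finite pmf \<Rightarrow> 'a pmf \<Rightarrow> real" where
  "rel_entropy Q P = (\<Sum>x\<in>UNIV. pmf Q x * ln (pmf Q x / pmf P x))"

definition pairing :: "('a::finite \<Rightarrow> real) \<Rightarrow> 'a pmf \<Rightarrow> real" where
  "pairing h Q = (\<Sum>x\<in>UNIV. h x * pmf Q x)"

definition constraint_set ::
    "(nat \<Rightarrow> 'a::finite \<Rightarrow> real) \<Rightarrow> (nat \<Rightarrow> real) \<Rightarrow> nat \<Rightarrow> nat \<Rightarrow> 'a pmf set" where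
  "constraint_set g \<alpha> r0 r =
     {Q. (\<forall>j\<in>{1..r0}. pairing (g j) Q = \<alpha> j) \<and> (\<forall>j\<in>{r0<..r}. pairing (g j) Q \<ge> \<alpha> j)}"

definition window_set ::
    "(nat \<Rightarrow> 'a::finite \<Rightarrow> real) \<Rightarrow> (nat \<Rightarrow> real) \<Rightarrow> nat \<Rightarrow> nat \<Rightarrow> real \<Rightarrow> 'a pmf set" where
  "window_set g \<alpha> r0 r \<epsilon> =
     {Q. (\<forall>j\<in>{1..r0}. \<bar>pairing (g j) Q - \<alpha> j\<bar> \<le> \<epsilon>) \<and>
         (\<forall>j\<in>{r0<..r}. pairing (g j) Q \<ge> \<alpha> j - \<epsilon>)}"

definition c_rnd :: "(nat \<Rightarrow> 'a::finite \<Rightarrow> real) \<Rightarrow> nat \<Rightarrow> real" where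
  "c_rnd g r = real CARD('a) * (MAX j\<in>{1..r}. MAX x. \<bar>g j x\<bar>)"

text \<open>For \<open>P\<close> of full support and \<open>S\<close> nonempty, closed and convex, the minimiser exists
  and is unique, so the choice made by \<open>arg_min\<close> is immaterial.\<close>
definition I_projection :: "'a::finite pmf \<Rightarrow> 'a pmf set \<Rightarrow> 'a pmf" where
  "I_projection P S = (ARG_MIN (\<lambda>Q. rel_entropy Q P) Q. Q \<in> S)"

definition projection_lipschitz ::
    "'a::finite pmf \<Rightarrow> (nat \<Rightarrow> 'a \<Rightarrow> real) \<Rightarrow> (nat \<Rightarrow> real) \<Rightarrow> nat \<Rightarrow> nat \<Rightarrow> real \<Rightarrow> bool" where
  "projection_lipschitz P g \<alpha> r0 r C0 \<longleftrightarrow>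
     (\<exists>\<eta>>0. \<forall>\<epsilon>\<in>{0..\<eta>}. \<forall>\<epsilon>'\<in>{0..\<eta>}.
        tv_dist (I_projection P (window_set g \<alpha> r0 r \<epsilon>))
                (I_projection P (window_set g \<alpha> r0 r \<epsilon>')) \<le> C0 * \<bar>\<epsilon> - \<epsilon>'\<bar>)"

text \<open>The law of \<open>I\<close>-indexed i.i.d. coordinates; outside \<open>I\<close> the functions take the
  value \<open>undefined\<close>, in agreement with \<open>restrict\<close> below.\<close>
definition iid :: "nat set \<Rightarrow> 'a pmf \<Rightarrow> (nat \<Rightarrow> 'a) pmf" where
  "iid I P = Pi_pmf I undefined (\<lambda>_. P)"

text \<open>The push-forward of the uniform law on the indices, i.e.
  \<open>(1/N) \<Sum>\<^sub>i \<delta>(X i)\<close>; meaningful for \<open>N \<ge> 1\<close>.\<close>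
definition empirical :: "nat \<Rightarrow> (nat \<Rightarrow> 'a) \<Rightarrow> 'a pmf" where
  "empirical N X = map_pmf X (pmf_of_set {1..N})"

text \<open>The law of \<open>X\<close> restricted to \<open>I\<close> under the \<open>N\<close>-fold product of \<open>P\<close>,
  conditioned on \<open>empirical N X \<in> S\<close>; meaningful when this event has positive
  probability.\<close>
definition cond_law ::
    "nat \<Rightarrow> nat set \<Rightarrow> 'a pmf \<Rightarrow> 'a pmf set \<Rightarrow> (nat \<Rightarrow> 'a) pmf" where
  "cond_law N I P S =
     map_pmf (\<lambda>X. restrict X I) (cond_pmf (iid {1..N} P) {X. empirical N X \<in> S})"

end

theory Submission
  imports Defs "HOL-Real_Asymp.Real_Asymp"
begin

text \<open>
  Under the conditioned law the sample is exchangeable, so its restriction to \<open>m\<close> indices looks like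
  sampling without replacement from the empirical measure. Replacing this by sampling with
  replacement costs the collision probability \<open>m (m - 1) / (2 N)\<close> (Diaconis--Freedman), and replacing
  the empirical measure by \<open>Q = P\<^sup>\<star>\<^sub>\<epsilon>\<close> costs \<open>m \<delta>\<close> plus the conditional probability of
  a deviation larger than \<open>\<delta>\<close>.

  For the latter, the Pythagorean inequality bounds the density of \<open>P\<close> against \<open>Q\<close> by
  \<open>exp (- N D(Q\<parallel>P))\<close> on the conditioning event, and Hoeffding's inequality for each of the \<open>2 ^ k\<close>
  events bounds the deviation under \<open>Q\<close>. The probability of the conditioning event is at least that
  of a single type class, obtained by rounding \<open>P\<^sup>\<star>\<^sub>\<epsilon>\<^sub>'\<close> with
  \<open>\<epsilon>' = \<epsilon> - c\<^sub>r\<^sub>n\<^sub>d / N\<close>. The Lipschitz assumption puts this type within \<open>O(1/N)\<close> of \<open>Q\<close>, so its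
  probability is \<open>exp (- N D(Q\<parallel>P))\<close> up to a constant and a factor \<open>(N + 1) ^ k\<close>. Rounding
  \<open>P\<^sup>\<star>\<close> itself would lose a factor exponential in \<open>N \<epsilon>\<close>.
\<close>

section \<open>Total variation distance\<close>

text \<open>Both laws have total mass 1, so the signed differences over a set and over its
  complement cancel. Each absolute sum dominates the signed one, with equality on both sides for the
  set where \<open>pmf p x\<close> is at least \<open>pmf q x\<close>.\<close>

lemma tv_dist_ge: "measure_pmf.prob p A - measure_pmf.prob q A \<le> tv_dist p q" (is ?ge)
  and tv_dist_attained: "\<exists>A. tv_dist p q = measure_pmf.prob p A - measure_pmf.prob q A" (is ?att)
proof -
  let ?d = "\<lambda>x. pmf p x - pmf q x"
  have d: "Infinite_Set_Sum.abs_summable_on ?d B" for B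
    by (intro abs_summable_on_diff pmf_abs_summable)
  have n: "Infinite_Set_Sum.abs_summable_on (\<lambda>x. \<bar>?d x\<bar>) B" for B
    using d[of B] by (simp flip: real_norm_def)
  have m: "infsetsum ?d B = measure_pmf.prob p B - measure_pmf.prob q B" for B
    by (simp add: infsetsum_diff pmf_abs_summable measure_pmf_conv_infsetsum)
  have "2 * tv_dist p q = infsetsum (\<lambda>x. \<bar>?d x\<bar>) UNIV"
    using n[of UNIV] by (simp add: tv_dist_def infsetsum_infsum)
  also have "\<dots> = infsetsum (\<lambda>x. \<bar>?d x\<bar>) B + infsetsum (\<lambda>x. \<bar>?d x\<bar>) (- B)" for B
    using infsetsum_Un_disjoint[OF n n, of B "- B"] by simp
  finally have split: "2 * tv_dist p q = infsetsum (\<lambda>x. \<bar>?d x\<bar>) B + infsetsum (\<lambda>x. \<bar>?d x\<bar>) (- B)" for B .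
  have compl: "measure_pmf.prob s (- B) = 1 - measure_pmf.prob s B" for s :: "'a pmf" and B
    using measure_pmf.prob_compl[of B s] by (simp add: Compl_eq_Diff_UNIV)
  have "\<bar>infsetsum ?d B\<bar> \<le> infsetsum (\<lambda>x. \<bar>?d x\<bar>) B" for B
    using norm_infsetsum_bound[of ?d B] by simp
  from this[of A] this[of "- A"] show ?ge
    using split[of A] by (simp add: m compl)
  define B where "B = {x. pmf p x \<ge> pmf q x}"
  have "infsetsum (\<lambda>x. \<bar>?d x\<bar>) B = infsetsum ?d B"
    by (intro infsetsum_cong) (auto simp: B_def)
  moreover have "infsetsum (\<lambda>x. \<bar>?d x\<bar>) (- B) = - infsetsum ?d (- B)"
    unfolding infsetsum_uminus[symmetric] by (intro infsetsum_cong) (auto simp: B_def)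
  ultimately show ?att
    using split[of B] by (intro exI[of _ B]) (simp add: m compl)
qed

lemma tv_dist_leI:
  "(\<And>A. measure_pmf.prob p A - measure_pmf.prob q A \<le> c) \<Longrightarrow> tv_dist p q \<le> c"
  using tv_dist_attained[of p q] by auto

lemma tv_dist_nonneg: "tv_dist p q \<ge> 0"
  using tv_dist_ge[of p "{}" q] by simp

lemma tv_dist_self [simp]: "tv_dist p p = 0"
  by (simp add: tv_dist_def)

lemma tv_dist_commute: "tv_dist p q = tv_dist q p"
  by (simp add: tv_dist_def abs_minus_commute)

lemma tv_dist_triangle: "tv_dist p q \<le> tv_dist p s + tv_dist s q"
proof (rule tv_dist_leI)
  fix A show "measure_pmf.prob p A - measure_pmf.prob q A \<le> tv_dist p s + tv_dist s q"
    using tv_dist_ge[of p A s] tv_dist_ge[of s A q] by linarith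
qed

lemma pmf_diff_le_tv_dist: "\<bar>pmf p x - pmf q x\<bar> \<le> tv_dist p q"
  using tv_dist_ge[of p "{x}" q] tv_dist_ge[of q "{x}" p]
  by (simp add: measure_pmf_single tv_dist_commute[of q])

lemma tv_dist_map_le: "tv_dist (map_pmf f p) (map_pmf f q) \<le> tv_dist p q"
  by (rule tv_dist_leI) (simp add: tv_dist_ge)

section \<open>Total variation of mixtures and products\<close>

lemma measure_bind_pmf_expectation:
  "measure_pmf.prob (bind_pmf \<mu> f) A = measure_pmf.expectation \<mu> (\<lambda>x. measure_pmf.prob (f x) A)"
proof -
  have i: "integrable (measure_pmf \<mu>) (\<lambda>x. measure_pmf.prob (f x) A)"
    by (rule measure_pmf.integrable_const_bound[where B = 1]) auto
  have "ennreal (measure_pmf.prob (bind_pmf \<mu> f) A) = (\<integral>\<^sup>+x. ennreal (measure_pmf.prob (f x) A) \<partial>\<mu>)"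
    by (simp flip: measure_pmf.emeasure_eq_measure)
  also have "\<dots> = ennreal (measure_pmf.expectation \<mu> (\<lambda>x. measure_pmf.prob (f x) A))"
    by (rule nn_integral_eq_integral[OF i]) simp
  finally show ?thesis by (simp add: integral_nonneg_AE)
qed

text \<open>On \<open>B\<close> a difference of probabilities is at most 1, elsewhere at most
  \<open>c\<close>. Two separate events are allowed so that \<open>A' = {}\<close> yields a bound
  for a single mixture.\<close>

lemma prob_bind_diff_le:
  assumes "c \<ge> 0"
    and le: "\<And>x. x \<in> set_pmf \<mu> \<Longrightarrow> x \<notin> B \<Longrightarrow> measure_pmf.prob (f x) A - measure_pmf.prob (h x) A' \<le> c"
  shows "measure_pmf.prob (bind_pmf \<mu> f) A - measure_pmf.prob (bind_pmf \<mu> h) A' \<le> c + measure_pmf.prob \<mu> B"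
proof -
  have i: "integrable (measure_pmf \<mu>) (\<lambda>x. measure_pmf.prob (F x) D)" for F :: "'a \<Rightarrow> 'd pmf" and D
    by (rule measure_pmf.integrable_const_bound[where B = 1]) auto
  have ind: "integrable (measure_pmf \<mu>) (indicat_real B)"
    by (rule measure_pmf.integrable_const_bound[where B = 1]) auto
  have "measure_pmf.prob (bind_pmf \<mu> f) A - measure_pmf.prob (bind_pmf \<mu> h) A'
      = measure_pmf.expectation \<mu> (\<lambda>x. measure_pmf.prob (f x) A - measure_pmf.prob (h x) A')"
    by (simp add: measure_bind_pmf_expectation i)
  also have "\<dots> \<le> measure_pmf.expectation \<mu> (\<lambda>x. c + indicator B x)"
  proof (rule integral_mono_AE)
    show "AE x in measure_pmf \<mu>. measure_pmf.prob (f x) A - measure_pmf.prob (h x) A' \<le> c + indicator B x"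
    proof (rule AE_pmfI)
      fix x assume x: "x \<in> set_pmf \<mu>"
      have "measure_pmf.prob (f x) A - measure_pmf.prob (h x) A' \<le> 1"
        by (smt (verit) measure_pmf.prob_le_1 measure_nonneg)
      with le[OF x] \<open>c \<ge> 0\<close>
      show "measure_pmf.prob (f x) A - measure_pmf.prob (h x) A' \<le> c + indicator B x"
        by (cases "x \<in> B") auto
    qed
  qed (auto intro!: i ind)
  also have "\<dots> = c + measure_pmf.prob \<mu> B"
    by (simp add: measure_pmf.prob_space ind)
  finally show ?thesis .
qed

lemma tv_dist_bind_le:
  assumes "c \<ge> 0" and "\<And>x. x \<in> set_pmf \<mu> \<Longrightarrow> x \<notin> B \<Longrightarrow> tv_dist (f x) (h x) \<le> c"
  shows "tv_dist (bind_pmf \<mu> f) (bind_pmf \<mu> h) \<le> c + measure_pmf.prob \<mu> B"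
proof (rule tv_dist_leI)
  show "measure_pmf.prob (bind_pmf \<mu> f) A - measure_pmf.prob (bind_pmf \<mu> h) A \<le> c + measure_pmf.prob \<mu> B" for A
    using assms by (intro prob_bind_diff_le) (force intro: order_trans[OF tv_dist_ge])+
qed

lemma prob_bind_le:
  assumes "c \<ge> 0" and "\<And>x. x \<in> set_pmf \<mu> \<Longrightarrow> x \<notin> B \<Longrightarrow> measure_pmf.prob (f x) A \<le> c"
  shows "measure_pmf.prob (bind_pmf \<mu> f) A \<le> c + measure_pmf.prob \<mu> B"
  using prob_bind_diff_le[of c \<mu> B f A f "{}"] assms by simp

text \<open>A hybrid argument: the intermediate law draws the new coordinate from \<open>p\<close>
  and the old ones from \<open>q\<close>, so each half of the triangle inequality changes one block
  only.\<close>

lemma tv_dist_iid_le: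
  assumes "finite I"
  shows "tv_dist (iid I p) (iid I q) \<le> real (card I) * tv_dist p q"
  using assms
proof (induction I rule: finite_induct)
  case empty
  then show ?case by (simp add: iid_def)
next
  case (insert i I)
  have ins: "iid (insert i I) s = bind_pmf s (\<lambda>y. map_pmf (\<lambda>f. f(i := y)) (iid I s))" for s :: "'a pmf"
    using insert.hyps by (simp add: iid_def Pi_pmf_insert' map_pmf_def)
  have "tv_dist (iid (insert i I) p) (bind_pmf p (\<lambda>y. map_pmf (\<lambda>f. f(i := y)) (iid I q)))
      \<le> real (card I) * tv_dist p q + measure_pmf.prob p {}"
    unfolding ins using insert.IH
    by (intro tv_dist_bind_le) (auto intro: order_trans[OF tv_dist_map_le] simp: tv_dist_nonneg)
  \<comment> \<open>With the order of the draws exchanged, the common mixing law is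
    \<open>iid I q\<close> and only the new coordinate differs.\<close>
  moreover have "bind_pmf s (\<lambda>y. map_pmf (\<lambda>f. f(i := y)) (iid I q))
      = bind_pmf (iid I q) (\<lambda>f. map_pmf (\<lambda>y. f(i := y)) s)" for s :: "'a pmf"
    by (simp add: map_pmf_def) (rule bind_commute_pmf)
  from this[of p] this[of q] have "tv_dist (bind_pmf p (\<lambda>y. map_pmf (\<lambda>f. f(i := y)) (iid I q))) (iid (insert i I) q)
      \<le> tv_dist p q + measure_pmf.prob (iid I q) {}"
    unfolding ins[of q] by (simp only:) (intro tv_dist_bind_le tv_dist_map_le tv_dist_nonneg)
  ultimately show ?case
    using tv_dist_triangle[of "iid (insert i I) p" "iid (insert i I) q"
        "bind_pmf p (\<lambda>y. map_pmf (\<lambda>f. f(i := y)) (iid I q))"] insert.hyps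
    by (simp add: algebra_simps)
qed

section \<open>Sampling with and without replacement\<close>

text \<open>The birthday bound: given distinct earlier values, a new draw hits one of them with
  probability at most \<open>card I / card A\<close>. Summing these gives the quadratic
  term.\<close>

lemma prob_iid_not_inj_le:
  fixes A :: "'a set"
  assumes "finite I" "finite A" "A \<noteq> {}"
  shows "measure_pmf.prob (iid I (pmf_of_set A)) {f. \<not> inj_on f I}
    \<le> real (card I) * (real (card I) - 1) / (2 * real (card A))"
  using assms(1)
proof (induction I rule: finite_induct)
  case empty
  then show ?case by (simp add: iid_def)
next
  case (insert i I)
  let ?u = "pmf_of_set A"
  have "iid (insert i I) ?u = bind_pmf (iid I ?u) (\<lambda>f. map_pmf (\<lambda>y. f(i := y)) ?u)"
    unfolding iid_def Pi_pmf_insert'[OF insert.hyps] map_pmf_def by (rule bind_commute_pmf)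
  also have "measure_pmf.prob \<dots> {f. \<not> inj_on f (insert i I)}
      \<le> real (card I) / real (card A) + measure_pmf.prob (iid I ?u) {f. \<not> inj_on f I}"
  proof (rule prob_bind_le)
    fix f :: "nat \<Rightarrow> 'a" assume "f \<notin> {f. \<not> inj_on f I}"
    then have f: "inj_on f I" by simp
    have "inj_on (f(i := y)) (insert i I)" if "y \<notin> f ` I" for y
      using f that insert.hyps by (auto simp: inj_on_def)
    then have "measure_pmf.prob (map_pmf (\<lambda>y. f(i := y)) ?u) {f. \<not> inj_on f (insert i I)}
        \<le> measure_pmf.prob ?u (f ` I)"
      by (auto intro!: measure_pmf.finite_measure_mono)
    also have "\<dots> = real (card (A \<inter> f ` I)) / real (card A)"
      using assms by (simp add: measure_pmf_of_set)
    also have "card (A \<inter> f ` I) \<le> card I"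
      using insert.hyps by (meson Int_lower2 card_image_le card_mono finite_imageI order_trans)
    then have "real (card (A \<inter> f ` I)) / real (card A) \<le> real (card I) / real (card A)"
      by (simp add: divide_right_mono)
    finally show "measure_pmf.prob (map_pmf (\<lambda>y. f(i := y)) ?u) {f. \<not> inj_on f (insert i I)}
        \<le> real (card I) / real (card A)" .
  qed simp
  also have "\<dots> \<le> real (card I) / real (card A) + real (card I) * (real (card I) - 1) / (2 * real (card A))"
    using insert.IH by simp
  also have "\<dots> = real (card (insert i I)) * (real (card (insert i I)) - 1) / (2 * real (card A))"
    using insert.hyps assms by (simp add: field_simps card_gt_0_iff)
  finally show ?case .
qed

text \<open>Turns reading a sample at distinct indices into permuting the whole sample; fixing all
  points outside \<open>A\<close> keeps the default coordinates in place.\<close>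

lemma extend_injection_to_permutation:
  assumes "finite A" "I \<subseteq> A" "inj_on f I" "f ` I \<subseteq> A"
  obtains \<pi> where "bij_betw \<pi> A A" "\<And>i. i \<in> I \<Longrightarrow> \<pi> i = f i" "\<And>i. i \<notin> A \<Longrightarrow> \<pi> i = i"
proof -
  have "card (f ` I) = card I"
    using assms by (simp add: card_image)
  then have "card (A - I) = card (A - f ` I)"
    using assms by (simp add: card_Diff_subset finite_subset)
  then obtain h where h: "bij_betw h (A - I) (A - f ` I)"
    using assms by (meson finite_Diff finite_same_card_bij)
  let ?p = "\<lambda>i. if i \<in> I then f i else if i \<in> A then h i else i"
  have "bij_betw ?p I (f ` I)"
    using assms by (subst bij_betw_cong[where g = f]) (auto simp: bij_betw_imageI)
  moreover have "bij_betw ?p (A - I) (A - f ` I)"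
    using h by (subst bij_betw_cong[where g = h]) auto
  ultimately have "bij_betw ?p (I \<union> (A - I)) (f ` I \<union> (A - f ` I))"
    by (rule bij_betw_combine) auto
  then have "bij_betw ?p A A"
    using assms by (simp add: Un_absorb1)
  then show ?thesis
    by (rule that) (use assms(2) in auto)
qed

lemma empirical_permute:
  assumes "bij_betw \<pi> {1..N} {1..N}" "N > 0"
  shows "empirical N (X \<circ> \<pi>) = empirical N X"
proof -
  have "map_pmf \<pi> (pmf_of_set {1..N}) = pmf_of_set {1..N}"
    using assms by (intro map_pmf_of_set_bij_betw) auto
  then show ?thesis
    unfolding empirical_def by (metis pmf.map_comp)
qed

text \<open>A permutation of the indices preserves the product law and the empirical measure, hence
  also the conditioned law. Any distinct indices therefore see the same law as \<open>I\<close>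
  itself.\<close>

lemma cond_law_exchangeable:
  fixes P :: "'a pmf"
  assumes "N > 0" "I \<subseteq> {1..N}" "inj_on f I" "f ` I \<subseteq> {1..N}"
    and ne: "set_pmf (iid {1..N} P) \<inter> {X. empirical N X \<in> S} \<noteq> {}"
  shows "map_pmf (\<lambda>X. restrict (X \<circ> f) I) (cond_pmf (iid {1..N} P) {X. empirical N X \<in> S})
    = cond_law N I P S"
proof -
  obtain \<pi> where p: "bij_betw \<pi> {1..N} {1..N}" "\<And>i. i \<in> I \<Longrightarrow> \<pi> i = f i" "\<And>i. i \<notin> {1..N} \<Longrightarrow> \<pi> i = i"
    using extend_injection_to_permutation[of "{1..N}" I f] assms by (metis finite_atLeastAtMost)
  define G where "G = (\<lambda>X :: nat \<Rightarrow> 'a. X \<circ> \<pi>)"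
  have M: "map_pmf G (iid {1..N} P) = iid {1..N} P"
    unfolding G_def iid_def
    using p by (intro Pi_pmf_bij_betw[symmetric]) auto
  have G: "empirical N (G X) = empirical N X" for X
    unfolding G_def by (rule empirical_permute[OF p(1) assms(1)])
  let ?E = "{X. empirical N X \<in> S}"
  \<comment> \<open>The conditioning event is its own preimage under \<open>G\<close>, so
    conditioning commutes with the push-forward.\<close>
  have E: "cond_pmf (iid {1..N} P) ?E = map_pmf G (cond_pmf (iid {1..N} P) ?E)"
    using cond_map_pmf[of "iid {1..N} P" G ?E] ne unfolding M by (metis (no_types, lifting) vimage_Collect_eq G Collect_cong)
  have "cond_law N I P S = map_pmf (\<lambda>X. restrict (G X) I) (cond_pmf (iid {1..N} P) ?E)"
    unfolding cond_law_def by (subst E) (simp only: pmf.map_comp o_def)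
  also have "(\<lambda>X. restrict (G X) I) = (\<lambda>X. restrict (X \<circ> f) I)"
    using p(2) by (simp add: G_def restrict_def fun_eq_iff)
  finally show ?thesis ..
qed

text \<open>For a fixed sample, independent draws from its empirical measure amount to reading the
  sample at independent uniform indices.\<close>

lemma iid_empirical:
  assumes "finite I" "N > 0"
  shows "map_pmf (\<lambda>f. restrict (X \<circ> f) I) (iid I (pmf_of_set {1..N})) = iid I (empirical N X)"
proof -
  \<comment> \<open>Composition with \<open>X\<close> sends the default \<open>undefined\<close> to
    \<open>X undefined\<close>, so the product is first formed with that default; the restriction to
    \<open>I\<close> resets it.\<close>
  have "iid I (empirical N X)
    = map_pmf (\<lambda>f x. if x \<in> I then f x else undefined) (Pi_pmf I (X undefined) (\<lambda>_. empirical N X))"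
    by (simp add: iid_def Pi_pmf_default_swap assms)
  also have "Pi_pmf I (X undefined) (\<lambda>_. empirical N X) = map_pmf (\<lambda>f. X \<circ> f) (iid I (pmf_of_set {1..N}))"
    by (simp add: iid_def empirical_def Pi_pmf_map assms)
  finally show ?thesis
    by (simp add: pmf.map_comp o_def restrict_def)
qed

text \<open>Drawing the indices first and the sample second makes the comparison exact for injective
  index choices, by exchangeability. Only collisions contribute.\<close>

lemma tv_dist_cond_law_mixture:
  fixes P :: "'a pmf"
  assumes "N > 0" "I \<subseteq> {1..N}"
    and ne: "set_pmf (iid {1..N} P) \<inter> {X. empirical N X \<in> S} \<noteq> {}"
  shows "tv_dist (cond_law N I P S)
      (bind_pmf (cond_pmf (iid {1..N} P) {X. empirical N X \<in> S}) (\<lambda>X. iid I (empirical N X)))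
    \<le> real (card I) * (real (card I) - 1) / (2 * real N)"
proof -
  define \<mu> where "\<mu> = cond_pmf (iid {1..N} P) {X. empirical N X \<in> S}"
  let ?U = "iid I (pmf_of_set {1..N})"
  have fin: "finite I" using assms(2) by (rule finite_subset) simp
  have "bind_pmf \<mu> (\<lambda>X. iid I (empirical N X)) = bind_pmf \<mu> (\<lambda>X. map_pmf (\<lambda>f. restrict (X \<circ> f) I) ?U)"
    by (simp only: iid_empirical[OF fin assms(1)])
  also have "\<dots> = bind_pmf ?U (\<lambda>f. map_pmf (\<lambda>X. restrict (X \<circ> f) I) \<mu>)"
    unfolding map_pmf_def by (rule bind_commute_pmf)
  finally have *: "bind_pmf \<mu> (\<lambda>X. iid I (empirical N X)) = \<dots>" .
  \<comment> \<open>The conditional law is written as a constant mixture over \<open>?U\<close>, so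
    that both sides share their mixing law.\<close>
  have "tv_dist (bind_pmf ?U (\<lambda>_. cond_law N I P S)) (bind_pmf ?U (\<lambda>f. map_pmf (\<lambda>X. restrict (X \<circ> f) I) \<mu>))
      \<le> 0 + measure_pmf.prob ?U {f. \<not> inj_on f I}"
  proof (rule tv_dist_bind_le)
    fix f assume f: "f \<in> set_pmf ?U" "f \<notin> {f. \<not> inj_on f I}"
    then have "f ` I \<subseteq> {1..N}"
      using set_Pi_pmf_subset'[OF fin, of undefined "\<lambda>_. pmf_of_set {1..N}"] assms(1)
      by (auto simp: iid_def PiE_dflt_def)
    then show "tv_dist (cond_law N I P S) (map_pmf (\<lambda>X. restrict (X \<circ> f) I) \<mu>) \<le> 0"
      using cond_law_exchangeable[of N I f P S] assms f(2) by (simp add: \<mu>_def)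
  qed simp
  also have "\<dots> \<le> real (card I) * (real (card I) - 1) / (2 * real N)"
    using prob_iid_not_inj_le[of I "{1..N}"] fin assms(1) by simp
  finally show ?thesis using * by (simp add: \<mu>_def)
qed

section \<open>Empirical measures and type classes\<close>

lemma prob_empirical:
  assumes "N > 0"
  shows "measure_pmf.prob (empirical N X) A = real (card {i\<in>{1..N}. X i \<in> A}) / real N"
proof -
  have "{1..N} \<inter> X -` A = {i\<in>{1..N}. X i \<in> A}" by auto
  then show ?thesis
    unfolding empirical_def measure_map_pmf using assms by (subst measure_pmf_of_set) auto
qed

lemma pmf_empirical:
  assumes "N > 0"
  shows "pmf (empirical N X) x = real (card {i\<in>{1..N}. X i = x}) / real N"
  using prob_empirical[OF assms, of X "{x}"] by (simp add: measure_pmf_single)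

lemma pairing_empirical:
  assumes "N > 0"
  shows "real N * pairing h (empirical N X) = (\<Sum>i\<in>{1..N}. h (X i))"
proof -
  have "(\<Sum>i\<in>{1..N}. h (X i)) = (\<Sum>x\<in>UNIV. \<Sum>i\<in>{i\<in>{1..N}. X i = x}. h (X i))"
    by (rule sum.group[symmetric]) auto
  also have "\<dots> = (\<Sum>x\<in>UNIV. real (card {i\<in>{1..N}. X i = x}) * h x)"
    by (intro sum.cong) auto
  finally show ?thesis
    using assms by (simp add: pairing_def pmf_empirical sum_distrib_left mult_ac del: One_nat_def)
qed

section \<open>Change of measure and concentration of the empirical measure\<close>

lemma prob_le_mult_prob:
  assumes "c \<ge> 0" "\<And>x. x \<in> A \<Longrightarrow> pmf p x \<le> c * pmf q x"
  shows "measure_pmf.prob p A \<le> c * measure_pmf.prob q A"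
proof -
  have "emeasure (measure_pmf p) A = (\<integral>\<^sup>+x. pmf p x \<partial>count_space A)"
    by (simp add: nn_integral_pmf)
  also have "\<dots> \<le> (\<integral>\<^sup>+x. ennreal c * pmf q x \<partial>count_space A)"
    using assms by (intro nn_integral_mono) (simp flip: ennreal_mult)
  also have "\<dots> = ennreal c * emeasure (measure_pmf q) A"
    by (simp add: nn_integral_cmult nn_integral_pmf)
  finally show ?thesis
    using assms(1) by (simp add: measure_pmf.emeasure_eq_measure flip: ennreal_mult)
qed

text \<open>The likelihood ratio of the two product laws at \<open>X\<close> depends on the
  empirical measure alone: it is the exponential of \<open>- N\<close> times the pairing in the
  hypothesis.\<close>

lemma prob_iid_change_of_measure:
  fixes P Q :: "'a::finite pmf"
  assumes P: "\<forall>x. pmf P x > 0" and Q: "\<forall>x. pmf Q x > 0" and "N > 0"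
    and A: "\<And>X. X \<in> A \<Longrightarrow> D \<le> pairing (\<lambda>x. ln (pmf Q x / pmf P x)) (empirical N X)"
  shows "measure_pmf.prob (iid {1..N} P) A \<le> exp (- real N * D) * measure_pmf.prob (iid {1..N} Q) A"
proof (rule prob_le_mult_prob)
  fix X assume X: "X \<in> A"
  let ?h = "\<lambda>x. ln (pmf Q x / pmf P x)"
  show "pmf (iid {1..N} P) X \<le> exp (- real N * D) * pmf (iid {1..N} Q) X"
  \<comment> \<open>The product formula for the masses requires default values off the index set;
    other functions have mass 0.\<close>
  proof (cases "\<forall>i. i \<notin> {1..N} \<longrightarrow> X i = undefined")
    case True
    then have iid: "pmf (iid {1..N} R) X = (\<Prod>i\<in>{1..N}. pmf R (X i))" for R
      unfolding iid_def by (intro pmf_Pi') auto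
    have "pmf P x = exp (- ?h x) * pmf Q x" for x
      using P[rule_format, of x] Q[rule_format, of x] by (simp add: exp_minus)
    then have "(\<Prod>i\<in>{1..N}. pmf P (X i)) = (\<Prod>i\<in>{1..N}. exp (- ?h (X i)) * pmf Q (X i))"
      by (rule prod.cong[OF refl])
    also have "\<dots> = exp (- (\<Sum>i\<in>{1..N}. ?h (X i))) * (\<Prod>i\<in>{1..N}. pmf Q (X i))"
      by (simp add: prod.distrib exp_sum sum_negf[symmetric] del: One_nat_def)
    also have "(\<Sum>i\<in>{1..N}. ?h (X i)) = real N * pairing ?h (empirical N X)"
      by (rule pairing_empirical[OF \<open>N > 0\<close>, symmetric])
    also have "exp (- (real N * pairing ?h (empirical N X))) * (\<Prod>i\<in>{1..N}. pmf Q (X i))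
        \<le> exp (- real N * D) * (\<Prod>i\<in>{1..N}. pmf Q (X i))"
      using A[OF X] by (intro mult_right_mono prod_nonneg) (auto intro: mult_left_mono)
    finally show ?thesis
      unfolding iid .
  next
    case False
    then have "pmf (iid {1..N} P) X = 0"
      unfolding iid_def by (intro pmf_Pi_outside) auto
    then show ?thesis by simp
  qed
qed simp

text \<open>The indicators of \<open>A\<close> along the sample are independent Bernoulli variables,
  so their number is binomial and Hoeffding's inequality applies.\<close>

lemma prob_iid_empirical_ge:
  assumes "N > 0" "\<delta> \<ge> 0"
  shows "measure_pmf.prob (iid {1..N} Q) {X. measure_pmf.prob (empirical N X) A \<ge> measure_pmf.prob Q A + \<delta>}
    \<le> exp (- 2 * real N * \<delta>\<^sup>2)"
proof -
  define p where "p = measure_pmf.prob Q A"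
  have p: "p \<in> {0..1}" by (simp add: p_def)
  have bern: "map_pmf (\<lambda>x. x \<in> A) Q = bernoulli_pmf p"
  proof (rule pmf_eqI)
    fix b
    have "measure_pmf.prob Q (- A) = 1 - p"
      using measure_pmf.prob_compl[of A Q] by (simp add: Compl_eq_Diff_UNIV p_def)
    moreover have "(\<lambda>x. x \<in> A) -` {b} = (if b then A else - A)" by auto
    ultimately show "pmf (map_pmf (\<lambda>x. x \<in> A) Q) b = pmf (bernoulli_pmf p) b"
      using p by (simp add: pmf_map p_def)
  qed
  have "map_pmf (\<lambda>X. card {i\<in>{1..N}. X i \<in> A}) (iid {1..N} Q)
    = map_pmf (\<lambda>f. card {i\<in>{1..N}. f i}) (map_pmf (\<lambda>X. (\<lambda>x. x \<in> A) \<circ> X) (iid {1..N} Q))"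
    by (simp add: pmf.map_comp o_def)
  also have "map_pmf (\<lambda>X. (\<lambda>x. x \<in> A) \<circ> X) (iid {1..N} Q) = Pi_pmf {1..N} (undefined \<in> A) (\<lambda>_. bernoulli_pmf p)"
    unfolding iid_def bern[symmetric] by (rule Pi_pmf_map[symmetric]) simp_all
  also have "map_pmf (\<lambda>f. card {i\<in>{1..N}. f i}) \<dots> = binomial_pmf N p"
    by (rule binomial_pmf_altdef'[symmetric]) (use p in auto)
  finally have *: "map_pmf (\<lambda>X. card {i\<in>{1..N}. X i \<in> A}) (iid {1..N} Q) = binomial_pmf N p" .
  have "measure_pmf.prob (iid {1..N} Q) {X. measure_pmf.prob (empirical N X) A \<ge> p + \<delta>}
    = measure_pmf.prob (binomial_pmf N p) {x. real x / real N \<ge> p + \<delta>}"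
    unfolding *[symmetric] measure_map_pmf prob_empirical[OF assms(1)] by (simp add: vimage_def)
  also have "\<dots> \<le> exp (- 2 * real N * \<delta>\<^sup>2)"
    using binomial_distribution.prob_ge'[of p N \<delta>] p assms by (simp add: binomial_distribution_def)
  finally show ?thesis by (simp add: p_def)
qed

text \<open>Since total variation is attained at some event, a union bound over all subsets of the
  alphabet suffices; it costs the factor \<open>2 ^ CARD('a)\<close>.\<close>

lemma prob_iid_tv_dist_empirical_gt:
  fixes Q :: "'a::finite pmf"
  assumes "N > 0" "\<delta> \<ge> 0"
  shows "measure_pmf.prob (iid {1..N} Q) {X. tv_dist (empirical N X) Q > \<delta>}
    \<le> 2 ^ CARD('a) * exp (- 2 * real N * \<delta>\<^sup>2)"
proof -
  let ?B = "\<lambda>A. {X. measure_pmf.prob (empirical N X) A \<ge> measure_pmf.prob Q A + \<delta>}"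
  have "{X. tv_dist (empirical N X) Q > \<delta>} \<subseteq> (\<Union>A. ?B A)"
  proof
    fix X assume "X \<in> {X. tv_dist (empirical N X) Q > \<delta>}"
    moreover obtain A where "tv_dist (empirical N X) Q = measure_pmf.prob (empirical N X) A - measure_pmf.prob Q A"
      using tv_dist_attained by blast
    ultimately show "X \<in> (\<Union>A. ?B A)" by (intro UN_I[of A]) auto
  qed
  then have "measure_pmf.prob (iid {1..N} Q) {X. tv_dist (empirical N X) Q > \<delta>}
    \<le> measure_pmf.prob (iid {1..N} Q) (\<Union>A. ?B A)"
    by (intro measure_pmf.finite_measure_mono) auto
  also have "\<dots> \<le> (\<Sum>A\<in>UNIV. measure_pmf.prob (iid {1..N} Q) (?B A))"
    by (intro measure_pmf.finite_measure_subadditive_finite) auto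
  also have "\<dots> \<le> (\<Sum>A\<in>(UNIV :: 'a set set). exp (- 2 * real N * \<delta>\<^sup>2))"
    by (intro sum_mono prob_iid_empirical_ge assms)
  also have "\<dots> = 2 ^ CARD('a) * exp (- 2 * real N * \<delta>\<^sup>2)"
    by (simp add: card_UNIV_set)
  finally show ?thesis .
qed

section \<open>Factorial bounds and the probability of a type class\<close>

lemma fact_ge_power_exp: "real n ^ n * exp (- real n) \<le> fact n"
proof -
  have s: "(\<lambda>k. real n ^ k /\<^sub>R fact k) sums exp (real n)"
    by (rule exp_converges)
  have "real n ^ n /\<^sub>R fact n \<le> exp (real n)"
    using sum_le_suminf[OF sums_summable[OF s], of "{n}"] sums_unique[OF s] by simp
  then show ?thesis by (simp add: exp_minus field_simps)
qed

text \<open>Induction from 1, driven by the fact that \<open>(1 + 1/n) ^ (n + 1)\<close> is at least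
  \<open>exp 1\<close>. The induction gives the factor \<open>n\<close>; enlarging it to
  \<open>n + 1\<close> covers the case 0 as well.\<close>

lemma fact_le_power_exp: "fact n \<le> exp 1 * (real n + 1) * (real n ^ n * exp (- real n))"
proof -
  have "fact n * exp (real n) \<le> exp 1 * real n * real n ^ n" if "n \<ge> 1" for n
    using that
  proof (induction n rule: dec_induct)
    case base
    then show ?case by simp
  next
    case (step n)
    have n: "real n > 0" using step by simp
    have "ln (real n / (real n + 1)) \<le> real n / (real n + 1) - 1"
      using n by (intro ln_le_minus_one) simp
    also have "\<dots> = - 1 / (real n + 1)" using n by (simp add: field_simps)
    finally have "(real n + 1) * ln (real n / (real n + 1)) \<le> - 1"
      using n by (simp add: field_simps)
    then have "1 + (real n + 1) * ln (real n) \<le> (real n + 1) * ln (real n + 1)"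
      using n by (simp add: ln_div algebra_simps)
    then have "exp (1 + real (Suc n) * ln (real n)) \<le> exp (real (Suc n) * ln (real n + 1))"
      by (simp add: algebra_simps)
    then have *: "exp 1 * real n ^ Suc n \<le> (real n + 1) ^ Suc n"
      using n by (simp only: exp_add exp_of_nat_mult) simp
    have "fact (Suc n) * exp (real (Suc n)) = (real n + 1) * exp 1 * (fact n * exp (real n))"
      by (simp add: exp_add algebra_simps)
    also have "\<dots> \<le> (real n + 1) * exp 1 * (exp 1 * real n * real n ^ n)"
      using step.IH by (intro mult_left_mono) auto
    also have "\<dots> = (real n + 1) * exp 1 * (exp 1 * real n ^ Suc n)"
      by simp
    also have "\<dots> \<le> (real n + 1) * exp 1 * ((real n + 1) ^ Suc n)"
      using * by (intro mult_left_mono) auto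
    finally show ?case by (simp add: algebra_simps)
  qed
  from this[of n] have "fact n * exp (real n) \<le> exp 1 * real n * real n ^ n" if "n \<noteq> 0"
    using that by simp
  also have "exp 1 * real n * real n ^ n \<le> exp 1 * (real n + 1) * real n ^ n"
    by (intro mult_right_mono mult_left_mono) auto
  finally have "fact n * exp (real n) \<le> exp 1 * (real n + 1) * real n ^ n"
    by (cases "n = 0") simp_all
  then show ?thesis by (simp add: exp_minus field_simps)
qed

text \<open>The multinomial coefficient, in multiplied form to stay within the natural numbers. The
  induction classifies functions by their value at the new point.\<close>

lemma card_functions_with_counts:
  fixes n :: "'a::finite \<Rightarrow> nat"
  assumes "finite A" "(\<Sum>x\<in>UNIV. n x) = card A"
  shows "card {X \<in> A \<rightarrow>\<^sub>E UNIV. \<forall>x. card {i\<in>A. X i = x} = n x} * (\<Prod>x\<in>UNIV. fact (n x)) = fact (card A)"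
  using assms
proof (induction A arbitrary: n rule: finite_induct)
  case empty
  then have "n = (\<lambda>_. 0)" by auto
  moreover have "{X. X = (\<lambda>x. undefined :: 'a)} = {\<lambda>x. undefined}" by auto
  ultimately show ?case by simp
next
  case (insert a A)
  let ?T = "\<lambda>A n. {X \<in> A \<rightarrow>\<^sub>E (UNIV :: 'a set). \<forall>x. card {i\<in>A. X i = x} = n x}"
  \<comment> \<open>The truncated subtraction is exact for letters in \<open>?Y\<close>; a letter of
    count 0 cannot be the value at \<open>a\<close>.\<close>
  let ?m = "\<lambda>y. n(y := n y - 1)"
  let ?Y = "{y. n y > 0}"
  have cnt: "card {i\<in>insert a A. (X(a := y)) i = x} = card {i\<in>A. X i = x} + (if x = y then 1 else 0)" for X x y
  proof -
    have "{i\<in>insert a A. (X(a := y)) i = x} = (if x = y then insert a {i\<in>A. X i = x} else {i\<in>A. X i = x})"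
      using insert.hyps by auto
    then show ?thesis using insert.hyps by auto
  qed
  have fin: "finite (?T A k)" for k
    by (rule finite_subset[OF _ finite_PiE[of A "\<lambda>_. UNIV"]]) (use insert.hyps in auto)
  have "?T (insert a A) n = (\<Union>y\<in>?Y. (\<lambda>X. X(a := y)) ` ?T A (?m y))"
  proof (intro equalityI subsetI)
    fix Z assume Z: "Z \<in> ?T (insert a A) n"
    define X where "X = Z(a := undefined)"
    have ZX: "Z = X(a := Z a)" by (simp add: X_def)
    have "X \<in> A \<rightarrow>\<^sub>E UNIV"
      using Z insert.hyps by (auto simp: X_def PiE_def extensional_def)
    moreover have c: "n x = card {i\<in>A. X i = x} + (if x = Z a then 1 else 0)" for x
      using Z cnt[of X "Z a" x] by (simp flip: ZX)
    ultimately have "X \<in> ?T A (?m (Z a))" by simp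
    moreover have "Z a \<in> ?Y" using c[of "Z a"] by simp
    ultimately show "Z \<in> (\<Union>y\<in>?Y. (\<lambda>X. X(a := y)) ` ?T A (?m y))"
      using ZX by blast
  next
    fix Z assume "Z \<in> (\<Union>y\<in>?Y. (\<lambda>X. X(a := y)) ` ?T A (?m y))"
    then obtain y X where y: "n y > 0" and X: "X \<in> ?T A (?m y)" and Z: "Z = X(a := y)" by blast
    have "card {i\<in>insert a A. Z i = x} = n x" for x
      unfolding Z cnt using X y by auto
    moreover have "Z \<in> insert a A \<rightarrow>\<^sub>E UNIV"
      using X by (auto simp: Z PiE_def extensional_def)
    ultimately show "Z \<in> ?T (insert a A) n" by blast
  qed
  also have "card \<dots> = (\<Sum>y\<in>?Y. card ((\<lambda>X. X(a := y)) ` ?T A (?m y)))"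
  proof (rule card_UN_disjoint)
    show "\<forall>y\<in>?Y. finite ((\<lambda>X. X(a := y)) ` ?T A (?m y))"
      using fin by blast
    show "\<forall>y\<in>?Y. \<forall>z\<in>?Y. y \<noteq> z \<longrightarrow> (\<lambda>X. X(a := y)) ` ?T A (?m y) \<inter> (\<lambda>X. X(a := z)) ` ?T A (?m z) = {}"
      by (auto dest: fun_upd_eqD)
  qed simp
  also have "\<dots> = (\<Sum>y\<in>?Y. card (?T A (?m y)))"
  proof (intro sum.cong refl card_image inj_onI)
    fix y X Z assume "X \<in> ?T A (?m y)" "Z \<in> ?T A (?m y)" and e: "X(a := y) = Z(a := y)"
    then have "X a = undefined" "Z a = undefined"
      using insert.hyps by (auto simp: PiE_def extensional_def)
    then show "X = Z" using e by (metis fun_upd_triv fun_upd_upd)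
  qed
  finally have "card (?T (insert a A) n) * (\<Prod>x\<in>UNIV. fact (n x)) = (\<Sum>y\<in>?Y. card (?T A (?m y)) * (\<Prod>x\<in>UNIV. fact (n x)))"
    by (simp add: sum_distrib_right)
  \<comment> \<open>Lowering one count removes the factor \<open>n y\<close> from the product of
    factorials, and the counts \<open>n y\<close> add up to \<open>card A + 1\<close>.\<close>
  also have "\<dots> = (\<Sum>y\<in>?Y. n y * fact (card A))"
  proof (intro sum.cong refl)
    fix y assume y: "y \<in> ?Y"
    have "(\<Sum>x\<in>UNIV. ?m y x) + 1 = (\<Sum>x\<in>UNIV. n x)"
      using y by (subst (1 2) sum.remove[of UNIV y]) auto
    then have "(\<Sum>x\<in>UNIV. ?m y x) = card A"
      using insert.prems insert.hyps by simp
    then have IH: "card (?T A (?m y)) * (\<Prod>x\<in>UNIV. fact (?m y x)) = fact (card A)"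
      by (rule insert.IH)
    have "(\<Prod>x\<in>UNIV. fact (n x)) = n y * (\<Prod>x\<in>UNIV. fact (?m y x) :: nat)"
      using y by (subst (1 2) prod.remove[of UNIV y]) (auto simp: fact_reduce)
    then show "card (?T A (?m y)) * (\<Prod>x\<in>UNIV. fact (n x)) = n y * fact (card A)"
      using IH by (simp add: mult_ac)
  qed
  also have "\<dots> = (\<Sum>y\<in>UNIV. n y) * fact (card A)"
    unfolding sum_distrib_right by (rule sum.mono_neutral_left) auto
  also have "\<dots> = fact (card (insert a A))"
    using insert.prems insert.hyps by simp
  finally show ?case .
qed

text \<open>All sequences of a type have equal mass, and the two factorial bounds estimate their
  number. Letters of count 0 are harmless: their power has exponent 0 and equals 1.\<close>

lemma prob_iid_counts_ge:
  fixes n :: "'a::finite \<Rightarrow> nat"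
  assumes "N > 0" "(\<Sum>x\<in>UNIV. n x) = N"
  shows "measure_pmf.prob (iid {1..N} P) {X. \<forall>x. card {i\<in>{1..N}. X i = x} = n x}
    \<ge> (\<Prod>x\<in>UNIV. (real N * pmf P x / real (n x)) ^ n x / (exp 1 * (real N + 1)))"
proof -
  let ?T = "{X \<in> {1..N} \<rightarrow>\<^sub>E (UNIV :: 'a set). \<forall>x. card {i\<in>{1..N}. X i = x} = n x}"
  have fin: "finite ?T"
    by (rule finite_subset[OF _ finite_PiE[of "{1..N}" "\<lambda>_. UNIV"]]) auto
  have cN: "card {1..N} = N" by simp
  have "card ?T * (\<Prod>x\<in>UNIV. fact (n x)) = fact N"
    by (rule card_functions_with_counts[of "{1..N}" n, unfolded cN, OF finite_atLeastAtMost assms(2)])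
  then have "real (card ?T * (\<Prod>x\<in>UNIV. fact (n x))) = real (fact N)"
    by (simp only:)
  then have "real (card ?T) * (\<Prod>x\<in>UNIV. fact (n x)) = fact N"
    by (simp only: of_nat_mult of_nat_prod of_nat_fact)
  moreover have "(\<Prod>x\<in>UNIV. fact (n x)) > (0::real)" by (intro prod_pos) simp
  ultimately have c: "real (card ?T) = fact N / (\<Prod>x\<in>UNIV. fact (n x))" by (simp add: field_simps)
  have pm: "pmf (iid {1..N} P) X = (\<Prod>x\<in>UNIV. pmf P x ^ n x)" if X: "X \<in> ?T" for X
  proof -
    have "\<forall>i. i \<notin> {1..N} \<longrightarrow> X i = undefined" using X by (auto simp: PiE_def extensional_def)
    then have "pmf (iid {1..N} P) X = (\<Prod>i\<in>{1..N}. pmf P (X i))"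
      unfolding iid_def by (intro pmf_Pi') auto
    also have "\<dots> = (\<Prod>x\<in>UNIV. \<Prod>i\<in>{i\<in>{1..N}. X i = x}. pmf P (X i))"
      by (rule prod.group[symmetric]) auto
    also have "\<dots> = (\<Prod>x\<in>UNIV. pmf P x ^ n x)"
      using X by (intro prod.cong) auto
    finally show ?thesis .
  qed
  have "(\<Prod>x\<in>UNIV. (real N * pmf P x / real (n x)) ^ n x / (exp 1 * (real N + 1)))
      \<le> (\<Prod>x\<in>UNIV. pmf P x ^ n x * (real N ^ n x * exp (- real (n x)) / fact (n x)))"
  proof (intro prod_mono conjI)
    fix x
    show "0 \<le> (real N * pmf P x / real (n x)) ^ n x / (exp 1 * (real N + 1))" by simp
    have "fact (n x) \<le> exp 1 * (real (n x) + 1) * (real (n x) ^ n x * exp (- real (n x)))"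
      by (rule fact_le_power_exp)
    also have "n x \<le> N" using assms(2) member_le_sum[of x UNIV n] by simp
    then have "exp 1 * (real (n x) + 1) * (real (n x) ^ n x * exp (- real (n x)))
        \<le> exp 1 * (real N + 1) * (real (n x) ^ n x * exp (- real (n x)))"
      by (intro mult_right_mono mult_left_mono) auto
    finally have f: "fact (n x) \<le> exp 1 * (real N + 1) * (real (n x) ^ n x * exp (- real (n x)))" .
    have pos: "real (n x) ^ n x > 0" by (cases "n x = 0") auto
    have "1 / (exp 1 * (real N + 1) * real (n x) ^ n x) \<le> exp (- real (n x)) / fact (n x)"
    proof -
      have "1 / (c * a) \<le> b / d" if "d \<le> c * (a * b)" "c > 0" "a > 0" "d > 0" for a b c d :: real
        using that by (simp add: divide_simps mult_ac)
      from this[OF f] pos show ?thesis by (simp add: add_pos_nonneg)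
    qed
    then have "(real N * pmf P x) ^ n x * (1 / (exp 1 * (real N + 1) * real (n x) ^ n x))
        \<le> (real N * pmf P x) ^ n x * (exp (- real (n x)) / fact (n x))"
      by (intro mult_left_mono) auto
    then show "(real N * pmf P x / real (n x)) ^ n x / (exp 1 * (real N + 1))
        \<le> pmf P x ^ n x * (real N ^ n x * exp (- real (n x)) / fact (n x))"
      by (simp add: power_divide power_mult_distrib mult_ac)
  qed
  \<comment> \<open>As the counts sum to \<open>N\<close>, the letterwise powers and exponentials
    combine into the lower bound for \<open>fact N\<close>.\<close>
  also have "\<dots> = (\<Prod>x\<in>UNIV. pmf P x ^ n x) * ((real N ^ N * exp (- real N)) / (\<Prod>x\<in>UNIV. fact (n x)))"
    unfolding prod.distrib prod_dividef using assms(2)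
    by (simp add: power_sum[symmetric] exp_sum[symmetric] sum_negf of_nat_sum[symmetric] del: of_nat_sum)
  also have "\<dots> \<le> (\<Prod>x\<in>UNIV. pmf P x ^ n x) * (fact N / (\<Prod>x\<in>UNIV. fact (n x)))"
    by (intro mult_left_mono divide_right_mono fact_ge_power_exp prod_nonneg) auto
  also have "\<dots> = (\<Sum>X\<in>?T. pmf (iid {1..N} P) X)"
    by (simp add: pm c[symmetric] del: One_nat_def)
  also have "\<dots> = measure_pmf.prob (iid {1..N} P) ?T"
    using fin by (simp add: measure_measure_pmf_finite)
  also have "\<dots> \<le> measure_pmf.prob (iid {1..N} P) {X. \<forall>x. card {i\<in>{1..N}. X i = x} = n x}"
    by (intro measure_pmf.finite_measure_mono) auto
  finally show ?thesis .
qed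

section \<open>The I-projection\<close>

text \<open>Only the boundary point 0 needs an argument: the limit there is 0, which is the value
  given by the convention \<open>0 log 0 = 0\<close>.\<close>

lemma continuous_on_x_ln: "continuous_on {0..} (\<lambda>x::real. x * ln (x / p))" if "p > 0"
proof -
  have lim: "((\<lambda>x::real. x * ln (x / p)) \<longlongrightarrow> 0) (at_right 0)"
    using that by real_asymp
  show ?thesis
    unfolding continuous_on_def
  proof
    fix x :: real assume x: "x \<in> {0..}"
    show "((\<lambda>x. x * ln (x / p)) \<longlongrightarrow> x * ln (x / p)) (at x within {0..})"
    proof (cases "x = 0")
      case True
      then show ?thesis
        using lim by (simp add: at_within_Ici_at_right)
    next
      case False
      with x that show ?thesis by (auto intro!: tendsto_intros)
    qed
  qed
qed

text \<open>Embedded into \<open>real ^ 'a\<close> by its masses, the simplex is compact, and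
  relative entropy is continuous up to its boundary.\<close>

lemma rel_entropy_attains_min:
  fixes P :: "'a::finite pmf" and C :: "(real ^ 'a) set"
  assumes P: "\<forall>x. pmf P x > 0" and "closed C" and ne: "{Q. (\<chi> x. pmf Q x) \<in> C} \<noteq> {}"
  shows "\<exists>Q. (\<chi> x. pmf Q x) \<in> C \<and> (\<forall>R. (\<chi> x. pmf R x) \<in> C \<longrightarrow> rel_entropy Q P \<le> rel_entropy R P)"
proof -
  let ?v = "\<lambda>Q. (\<chi> x. pmf Q x) :: real ^ 'a"
  define K where "K = {v :: real ^ 'a. (\<forall>x. 0 \<le> v $ x) \<and> (\<Sum>x\<in>UNIV. v $ x) = 1} \<inter> C"
  have vK: "?v Q \<in> K \<longleftrightarrow> ?v Q \<in> C" for Q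
    by (simp add: K_def sum_pmf_eq_1)
  \<comment> \<open>Every vector of \<open>K\<close> comes from a law, so a minimiser among vectors
    is one among laws.\<close>
  have Kv: "\<exists>Q. v = ?v Q" if "v \<in> K" for v
  proof (intro exI)
    have "(\<integral>\<^sup>+x. ennreal (v $ x) \<partial>count_space UNIV) = 1"
      using that by (simp add: nn_integral_count_space_finite K_def)
    then have "pmf (embed_pmf (\<lambda>x. v $ x)) x = v $ x" for x
      using that by (intro pmf_embed_pmf) (auto simp: K_def)
    then show "v = ?v (embed_pmf (\<lambda>x. v $ x))"
      by (simp add: vec_eq_iff)
  qed
  have "closed {v :: real ^ 'a. (\<forall>x. 0 \<le> v $ x) \<and> (\<Sum>x\<in>UNIV. v $ x) = 1}"
    by (intro closed_Collect_conj closed_Collect_all closed_Collect_le closed_Collect_eq continuous_intros)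
  then have "closed K" unfolding K_def using \<open>closed C\<close> by (rule closed_Int)
  moreover have "bounded K"
  proof (rule boundedI)
    fix v assume "v \<in> K"
    then have "(\<Sum>x\<in>UNIV. \<bar>v $ x\<bar>) = 1" by (simp add: K_def)
    then show "norm v \<le> 1" using norm_le_l1_cart[of v] by simp
  qed
  ultimately have "compact K" by (simp add: compact_eq_bounded_closed)
  moreover have "K \<noteq> {}" using ne vK by blast
  moreover have "continuous_on K (\<lambda>v. \<Sum>x\<in>UNIV. v $ x * ln (v $ x / pmf P x))"
  proof (intro continuous_on_sum)
    fix x
    have "continuous_on ((\<lambda>v. v $ x) ` K) (\<lambda>y. y * ln (y / pmf P x))"
      using P by (intro continuous_on_subset[OF continuous_on_x_ln]) (auto simp: K_def)
    from continuous_on_compose2[OF this _ subset_refl]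
    show "continuous_on K (\<lambda>v. v $ x * ln (v $ x / pmf P x))"
      by (simp add: continuous_on_component)
  qed
  ultimately obtain v where v: "v \<in> K"
    "\<forall>w\<in>K. (\<Sum>x\<in>UNIV. v $ x * ln (v $ x / pmf P x)) \<le> (\<Sum>x\<in>UNIV. w $ x * ln (w $ x / pmf P x))"
    by (meson continuous_attains_inf)
  from Kv[OF v(1)] obtain Q where "v = ?v Q" by blast
  with v vK have "?v Q \<in> C"
    "\<And>R. ?v R \<in> C \<Longrightarrow> (\<Sum>x\<in>UNIV. ?v Q $ x * ln (?v Q $ x / pmf P x)) \<le> (\<Sum>x\<in>UNIV. ?v R $ x * ln (?v R $ x / pmf P x))"
    by blast+
  then show ?thesis
    by (intro exI[of _ Q]) (simp add: rel_entropy_def)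
qed

text \<open>\<open>arg_min\<close> is a choice, so its defining property is available only once some
  minimiser is known to exist.\<close>

lemma I_projection_window_set:
  fixes P :: "'a::finite pmf"
  assumes P: "\<forall>x. pmf P x > 0" and ne: "window_set g \<alpha> r0 r \<epsilon> \<noteq> {}"
  shows "I_projection P (window_set g \<alpha> r0 r \<epsilon>) \<in> window_set g \<alpha> r0 r \<epsilon>" (is ?in)
    and "R \<in> window_set g \<alpha> r0 r \<epsilon> \<Longrightarrow> rel_entropy (I_projection P (window_set g \<alpha> r0 r \<epsilon>)) P \<le> rel_entropy R P"
proof -
  let ?S = "window_set g \<alpha> r0 r \<epsilon>"
  define C where "C = {v :: real ^ 'a. (\<forall>j\<in>{1..r0}. \<bar>(\<Sum>x\<in>UNIV. g j x * v $ x) - \<alpha> j\<bar> \<le> \<epsilon>) \<and>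
    (\<forall>j\<in>{r0<..r}. (\<Sum>x\<in>UNIV. g j x * v $ x) \<ge> \<alpha> j - \<epsilon>)}"
  have "closed C"
    unfolding C_def Ball_def
    by (intro closed_Collect_conj closed_Collect_all closed_Collect_imp closed_Collect_le continuous_intros) auto
  moreover have S: "(\<chi> x. pmf Q x) \<in> C \<longleftrightarrow> Q \<in> ?S" for Q
    by (simp add: C_def window_set_def pairing_def)
  ultimately obtain Q where Q: "Q \<in> ?S" "\<forall>R. R \<in> ?S \<longrightarrow> rel_entropy Q P \<le> rel_entropy R P"
    using rel_entropy_attains_min[OF P, of C] ne by auto
  then have "is_arg_min (\<lambda>Q. rel_entropy Q P) (\<lambda>Q. Q \<in> ?S) Q"
    by (simp add: is_arg_min_linorder)
  then have "is_arg_min (\<lambda>Q. rel_entropy Q P) (\<lambda>Q. Q \<in> ?S) (I_projection P ?S)"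
    unfolding I_projection_def arg_min_def by (rule someI)
  then show ?in and "R \<in> ?S \<Longrightarrow> rel_entropy (I_projection P ?S) P \<le> rel_entropy R P"
    by (simp_all add: is_arg_min_linorder)
qed

lemma window_set_convex:
  assumes "Q \<in> window_set g \<alpha> r0 r \<epsilon>" "T \<in> window_set g \<alpha> r0 r \<epsilon>" "0 \<le> t" "t \<le> 1"
    and R: "\<And>x. pmf R x = pmf Q x + t * (pmf T x - pmf Q x)"
  shows "R \<in> window_set g \<alpha> r0 r \<epsilon>"
proof -
  have p: "pairing h R = (1 - t) * pairing h Q + t * pairing h T" for h
    by (simp add: pairing_def R algebra_simps sum.distrib sum_subtractf sum_distrib_left)
  have lo: "(1 - t) * a + t * b \<ge> c" if "a \<ge> c" "b \<ge> c" for a b c :: real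
    using that assms(3,4) convex_bound_le[of "-a" "-c" "-b" "1 - t" t] by simp
  have up: "(1 - t) * a + t * b \<le> c" if "a \<le> c" "b \<le> c" for a b c :: real
    using that assms(3,4) convex_bound_le[of a c b "1 - t" t] by simp
  show ?thesis
    using assms(1,2) by (auto simp: window_set_def p abs_diff_le_iff intro!: lo up)
qed

text \<open>The first-order condition at the minimiser, which is the Pythagorean inequality
  \<open>D(T\<parallel>P) \<ge> D(T\<parallel>Q) + D(Q\<parallel>P)\<close> after cancelling \<open>D(T\<parallel>Q)\<close>.\<close>
lemma pythagorean_inequality:
  fixes P Q T :: "'a::finite pmf"
  assumes P: "\<forall>x. pmf P x > 0" and Q: "\<forall>x. pmf Q x > 0"
    and min: "\<And>t R. 0 \<le> t \<Longrightarrow> t \<le> 1 \<Longrightarrow> (\<And>x. pmf R x = pmf Q x + t * (pmf T x - pmf Q x)) \<Longrightarrow>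
      rel_entropy Q P \<le> rel_entropy R P"
  shows "rel_entropy Q P \<le> pairing (\<lambda>x. ln (pmf Q x / pmf P x)) T"
proof (rule ccontr)
  assume neg: "\<not> ?thesis"
  \<comment> \<open>Relative entropy to \<open>P\<close> along the line from \<open>Q\<close>
    through \<open>T\<close>, as a formula in all real \<open>t\<close>. Full support of
    \<open>Q\<close> makes it differentiable at 0, an endpoint of the segment.\<close>
  define \<phi> where "\<phi> = (\<lambda>t. \<Sum>x\<in>UNIV. (pmf Q x + t * (pmf T x - pmf Q x)) *
    ln ((pmf Q x + t * (pmf T x - pmf Q x)) / pmf P x))"
  have "((\<lambda>t. (pmf Q x + t * (pmf T x - pmf Q x)) * ln ((pmf Q x + t * (pmf T x - pmf Q x)) / pmf P x))
      has_real_derivative ((pmf T x - pmf Q x) * ln (pmf Q x / pmf P x) + (pmf T x - pmf Q x))) (at 0)" for x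
    using P[rule_format, of x] Q[rule_format, of x]
    by (auto intro!: derivative_eq_intros simp: field_simps)
  then have "(\<phi> has_real_derivative
      (\<Sum>x\<in>UNIV. (pmf T x - pmf Q x) * ln (pmf Q x / pmf P x) + (pmf T x - pmf Q x))) (at 0)"
    unfolding \<phi>_def by (intro DERIV_sum)
  \<comment> \<open>The summands \<open>pmf T x - pmf Q x\<close> cancel in total, as both laws have
    mass 1.\<close>
  moreover have "(\<Sum>x\<in>UNIV. (pmf T x - pmf Q x) * ln (pmf Q x / pmf P x) + (pmf T x - pmf Q x))
      = pairing (\<lambda>x. ln (pmf Q x / pmf P x)) T - rel_entropy Q P"
    by (simp add: pairing_def rel_entropy_def algebra_simps sum.distrib sum_subtractf sum_pmf_eq_1)
  ultimately have "(\<phi> has_real_derivative (pairing (\<lambda>x. ln (pmf Q x / pmf P x)) T - rel_entropy Q P)) (at 0)"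
    by simp
  from DERIV_neg_dec_right[OF this] neg
  obtain d where d: "d > 0" "\<And>h. 0 < h \<Longrightarrow> h < d \<Longrightarrow> \<phi> h < \<phi> 0" by auto
  define t where "t = min 1 (d / 2)"
  have t: "0 < t" "t \<le> 1" "t < d" using d(1) by (auto simp: t_def)
  \<comment> \<open>A law realising the point \<open>t\<close> of the segment, where
    \<open>\<phi>\<close> has already dropped below its value at \<open>Q\<close>.\<close>
  let ?R = "bind_pmf (bernoulli_pmf t) (\<lambda>b. if b then T else Q)"
  have R: "pmf ?R x = pmf Q x + t * (pmf T x - pmf Q x)" for x
    using t by (simp add: pmf_bind algebra_simps)
  have "rel_entropy Q P \<le> rel_entropy ?R P"
    using min[of t ?R] t R by simp
  moreover have "rel_entropy ?R P = \<phi> t" "rel_entropy Q P = \<phi> 0"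
    by (simp_all only: rel_entropy_def \<phi>_def R mult_zero_left add_0_right)
  ultimately show False using d(2)[of t] t by simp
qed

text \<open>Convexity keeps the segment towards \<open>T\<close> inside the window. The bound is
  what the change of measure needs when \<open>T\<close> is the empirical measure.\<close>

lemma I_projection_pythagorean:
  fixes P :: "'a::finite pmf"
  assumes P: "\<forall>x. pmf P x > 0" and Q: "\<forall>x. pmf (I_projection P (window_set g \<alpha> r0 r \<epsilon>)) x > 0"
    and T: "T \<in> window_set g \<alpha> r0 r \<epsilon>"
  shows "rel_entropy (I_projection P (window_set g \<alpha> r0 r \<epsilon>)) P
    \<le> pairing (\<lambda>x. ln (pmf (I_projection P (window_set g \<alpha> r0 r \<epsilon>)) x / pmf P x)) T"
proof (rule pythagorean_inequality[OF P Q])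
  fix t R
  assume "0 \<le> t" "t \<le> 1" "\<And>x. pmf R x = pmf (I_projection P (window_set g \<alpha> r0 r \<epsilon>)) x
    + t * (pmf T x - pmf (I_projection P (window_set g \<alpha> r0 r \<epsilon>)) x)"
  moreover have ne: "window_set g \<alpha> r0 r \<epsilon> \<noteq> {}" using T by auto
  ultimately have "R \<in> window_set g \<alpha> r0 r \<epsilon>"
    using window_set_convex[OF I_projection_window_set(1)[OF P ne] T] by blast
  then show "rel_entropy (I_projection P (window_set g \<alpha> r0 r \<epsilon>)) P \<le> rel_entropy R P"
    by (rule I_projection_window_set(2)[OF P ne])
qed

section \<open>The probability of the conditioning event\<close>

text \<open>Take logarithms and split \<open>p / (n / N)\<close> at \<open>q\<close>. Replacing
  \<open>n\<close> by \<open>N q\<close> in front of \<open>ln (p / q)\<close> costs at most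
  \<open>B * L\<close>; the rest costs at most \<open>B / q0\<close> by
  \<open>ln u \<le> u - 1\<close>. Neither loss grows with \<open>N\<close>.\<close>

lemma power_ratio_ge_exp:
  fixes n :: nat and p q :: real
  assumes "p > 0" "q \<ge> q0" "q0 > 0" "N > 0" "\<bar>ln (p / q)\<bar> \<le> L"
    and "\<bar>real n - real N * q\<bar> \<le> B" and "n \<le> N"
  shows "(real N * p / real n) ^ n \<ge> exp (real N * (q * ln (p / q)) - B * L - B / q0)"
proof -
  have q: "q > 0" using assms by simp
  have B: "B \<ge> 0" using assms by linarith
  have "\<bar>(real n - real N * q) * ln (p / q)\<bar> \<le> B * L"
    unfolding abs_mult using assms B by (intro mult_mono) auto
  then have 1: "(real n - real N * q) * ln (p / q) \<ge> - (B * L)" by linarith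
  show ?thesis
  proof (cases "n = 0")
    \<comment> \<open>The left side is 1 here, and the bound \<open>B * L\<close> already covers the
      exponent.\<close>
    case True
    with 1 have "real N * (q * ln (p / q)) - B * L \<le> 0" by (simp add: mult_ac)
    moreover have "B / q0 \<ge> 0" using B assms by simp
    ultimately show ?thesis using True by simp
  next
    case False
    then have n: "real n > 0" by simp
    have Nq: "real N * q > 0" using q assms by simp
    have "real n * ln (real n / (real N * q)) \<le> real n * (real n / (real N * q) - 1)"
      using n Nq by (intro mult_left_mono ln_le_minus_one) auto
    also have "\<dots> = (real n / real N) * ((real n - real N * q) / q)"
      using Nq q assms by (simp add: field_simps)
    also have "\<dots> \<le> (real n / real N) * (B / q)"
      using q assms by (intro mult_left_mono divide_right_mono) auto
    also have "\<dots> \<le> 1 * (B / q)"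
      using q B assms by (intro mult_right_mono) auto
    also have "\<dots> \<le> B / q0"
      using q B assms by (simp add: frac_le)
    finally have 2: "real n * ln (real n / (real N * q)) \<le> B / q0" .
    have "ln (real N * p / real n) = ln (p / q) - ln (real n / (real N * q))"
      using n q assms by (simp add: ln_div ln_mult)
    then have "real n * ln (real N * p / real n) = real n * ln (p / q) - real n * ln (real n / (real N * q))"
      by (simp only: right_diff_distrib)
    moreover have "real n * ln (p / q) = real N * (q * ln (p / q)) + (real n - real N * q) * ln (p / q)"
      by (simp add: left_diff_distrib)
    ultimately have "real N * (q * ln (p / q)) - B * L - B / q0 \<le> real n * ln (real N * p / real n)"
      using 1 2 by linarith
    then have "exp (real N * (q * ln (p / q)) - B * L - B / q0) \<le> exp (real n * ln (real N * p / real n))"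
      by simp
    also have "\<dots> = (real N * p / real n) ^ n"
      using n assms by (simp add: exp_of_nat_mult)
    finally show ?thesis .
  qed
qed

text \<open>The letterwise bounds multiply to the entropy exponent. The summand 1 in the error
  absorbs the factor \<open>exp 1\<close> of the factorial bound.\<close>

lemma prob_iid_counts_ge_rel_entropy:
  fixes P Q :: "'a::finite pmf" and n :: "'a \<Rightarrow> nat"
  assumes P: "\<forall>x. pmf P x > 0" and Q: "\<And>x. pmf Q x \<ge> q0" "q0 > 0"
    and L: "\<And>x. \<bar>ln (pmf P x / pmf Q x)\<bar> \<le> L"
    and "N > 0" and n: "(\<Sum>x\<in>UNIV. n x) = N" and B: "\<And>x. \<bar>real (n x) - real N * pmf Q x\<bar> \<le> B"
  shows "measure_pmf.prob (iid {1..N} P) {X. \<forall>x. card {i\<in>{1..N}. X i = x} = n x}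
    \<ge> exp (- real N * rel_entropy Q P) * exp (- real CARD('a) * (1 + B * L + B / q0)) / (real N + 1) ^ CARD('a)"
proof -
  have Q0: "pmf Q x > 0" for x using Q(1)[of x] Q(2) by simp
  have flip: "ln (pmf P x / pmf Q x) = - ln (pmf Q x / pmf P x)" for x
    using P[rule_format, of x] Q0[of x] by (simp add: ln_div)
  have "- real N * rel_entropy Q P + - real CARD('a) * (1 + B * L + B / q0)
    = (\<Sum>x\<in>UNIV. real N * (pmf Q x * ln (pmf P x / pmf Q x)) - (1 + B * L + B / q0))"
    by (simp add: sum_subtractf rel_entropy_def flip sum_negf sum_distrib_left)
  then have "exp (- real N * rel_entropy Q P) * exp (- real CARD('a) * (1 + B * L + B / q0)) / (real N + 1) ^ CARD('a)
    = exp (\<Sum>x\<in>UNIV. real N * (pmf Q x * ln (pmf P x / pmf Q x)) - (1 + B * L + B / q0)) / (real N + 1) ^ CARD('a)"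
    by (simp only: exp_add[symmetric])
  also have "\<dots> = (\<Prod>x\<in>UNIV. exp (real N * (pmf Q x * ln (pmf P x / pmf Q x)) - (1 + B * L + B / q0)) / (real N + 1))"
    by (simp add: exp_sum prod_dividef)
  also have "\<dots> \<le> (\<Prod>x\<in>UNIV. (real N * pmf P x / real (n x)) ^ n x / (exp 1 * (real N + 1)))"
  proof (intro prod_mono conjI)
    fix x
    have "n x \<le> N" using n member_le_sum[of x UNIV n] by simp
    then have "exp (real N * (pmf Q x * ln (pmf P x / pmf Q x)) - B * L - B / q0) \<le> (real N * pmf P x / real (n x)) ^ n x"
      using assms by (intro power_ratio_ge_exp) auto
    then have "exp (real N * (pmf Q x * ln (pmf P x / pmf Q x)) - B * L - B / q0) / (exp 1 * (real N + 1))
      \<le> (real N * pmf P x / real (n x)) ^ n x / (exp 1 * (real N + 1))"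
      by (intro divide_right_mono) auto
    moreover have "exp (real N * (pmf Q x * ln (pmf P x / pmf Q x)) - (1 + B * L + B / q0)) / (real N + 1)
      = exp (real N * (pmf Q x * ln (pmf P x / pmf Q x)) - B * L - B / q0) / (exp 1 * (real N + 1))"
      by (simp add: exp_diff exp_add)
    ultimately show "exp (real N * (pmf Q x * ln (pmf P x / pmf Q x)) - (1 + B * L + B / q0)) / (real N + 1)
      \<le> (real N * pmf P x / real (n x)) ^ n x / (exp 1 * (real N + 1))"
      by simp
  qed simp
  also have "\<dots> \<le> measure_pmf.prob (iid {1..N} P) {X. \<forall>x. card {i\<in>{1..N}. X i = x} = n x}"
    by (rule prob_iid_counts_ge[OF \<open>N > 0\<close> n])
  finally show ?thesis .
qed

section \<open>Rounding a law to a type inside the window\<close>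

lemma pmf_rounding:
  fixes Q :: "'a::finite pmf"
  obtains n :: "'a \<Rightarrow> nat" where "(\<Sum>x\<in>UNIV. n x) = N" "\<And>x. \<bar>real (n x) - real N * pmf Q x\<bar> \<le> 1"
proof -
  define f where "f = (\<lambda>x. nat \<lfloor>real N * pmf Q x\<rfloor>)"
  have f: "real (f x) \<le> real N * pmf Q x" "real N * pmf Q x \<le> real (f x) + 1" for x
  proof -
    have "0 \<le> real N * pmf Q x" by simp
    then have "real (f x) = of_int \<lfloor>real N * pmf Q x\<rfloor>" by (simp add: f_def)
    then show "real (f x) \<le> real N * pmf Q x" "real N * pmf Q x \<le> real (f x) + 1" by linarith+
  qed
  have s: "(\<Sum>x\<in>UNIV. real N * pmf Q x) = real N"
    by (simp add: sum_distrib_left[symmetric] sum_pmf_eq_1)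
  have "(\<Sum>x\<in>UNIV. real (f x)) \<le> (\<Sum>x\<in>UNIV. real N * pmf Q x)"
    by (intro sum_mono f)
  then have le: "(\<Sum>x\<in>UNIV. f x) \<le> N"
    unfolding s by (simp flip: of_nat_sum)
  have "(\<Sum>x\<in>UNIV. real N * pmf Q x) \<le> (\<Sum>x\<in>UNIV. real (f x) + 1)"
    by (intro sum_mono f)
  then have "real N \<le> real ((\<Sum>x\<in>UNIV. f x) + CARD('a))"
    unfolding s by (simp add: sum.distrib)
  \<comment> \<open>Rounding down loses at most 1 per letter, so raising distinct letters by 1 makes
    up the deficit.\<close>
  then have "N - (\<Sum>x\<in>UNIV. f x) \<le> CARD('a)"
    by linarith
  then obtain D :: "'a set" where D: "card D = N - (\<Sum>x\<in>UNIV. f x)"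
    using obtain_subset_with_card_n[of _ "UNIV :: 'a set"] by metis
  let ?n = "\<lambda>x. f x + (if x \<in> D then 1 else 0)"
  have "(\<Sum>x\<in>UNIV. ?n x) = N"
    using D le by (simp add: sum.distrib sum.If_cases)
  moreover have "\<bar>real (?n x) - real N * pmf Q x\<bar> \<le> 1" for x
    using f[of x] by auto
  ultimately show ?thesis by (rule that)
qed

lemma abs_le_Max_Max:
  fixes g :: "nat \<Rightarrow> 'a::finite \<Rightarrow> real"
  assumes "j \<in> {1..r}"
  shows "\<bar>g j x\<bar> \<le> (MAX j\<in>{1..r}. MAX x. \<bar>g j x\<bar>)"
proof -
  have "\<bar>g j x\<bar> \<le> (MAX x. \<bar>g j x\<bar>)" by (intro Max_ge) auto
  also have "\<dots> \<le> (MAX j\<in>{1..r}. MAX x. \<bar>g j x\<bar>)" using assms by (intro Max_ge) auto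
  finally show ?thesis .
qed

lemma c_rnd_nonneg:
  fixes g :: "nat \<Rightarrow> 'a::finite \<Rightarrow> real"
  assumes "1 \<le> r"
  shows "c_rnd g r \<ge> 0"
proof -
  have "0 \<le> \<bar>g 1 undefined\<bar>" by simp
  also have "\<dots> \<le> (MAX j\<in>{1..r}. MAX x. \<bar>g j x\<bar>)"
    using assms by (intro abs_le_Max_Max) simp
  finally show ?thesis by (simp add: c_rnd_def)
qed

text \<open>Each constraint moves by at most the alphabet size times the largest coefficient times
  \<open>d\<close>; this is the origin of \<open>c_rnd\<close>.\<close>

lemma window_set_rounding:
  fixes Q :: "'a::finite pmf"
  assumes "r0 \<le> r" and Q: "Q \<in> window_set g \<alpha> r0 r \<epsilon>"
    and T: "\<And>x. \<bar>pmf T x - pmf Q x\<bar> \<le> d"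
  shows "T \<in> window_set g \<alpha> r0 r (\<epsilon> + c_rnd g r * d)"
proof -
  have "\<bar>pairing (g j) T - pairing (g j) Q\<bar> \<le> c_rnd g r * d" if j: "j \<in> {1..r}" for j
  proof -
    have "\<bar>pairing (g j) T - pairing (g j) Q\<bar> = \<bar>\<Sum>x\<in>UNIV. g j x * (pmf T x - pmf Q x)\<bar>"
      by (simp add: pairing_def sum_subtractf algebra_simps)
    also have "\<dots> \<le> (\<Sum>x\<in>UNIV. \<bar>g j x * (pmf T x - pmf Q x)\<bar>)" by (rule sum_abs)
    also have "\<dots> \<le> (\<Sum>x\<in>(UNIV :: 'a set). (MAX j\<in>{1..r}. MAX x. \<bar>g j x\<bar>) * d)"
      unfolding abs_mult using abs_le_Max_Max[OF j] T
      by (intro sum_mono mult_mono) (auto intro: order_trans[OF abs_ge_zero])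
    finally show ?thesis by (simp add: c_rnd_def)
  qed
  then have "\<forall>j\<in>{1..r}. \<bar>pairing (g j) T - pairing (g j) Q\<bar> \<le> c_rnd g r * d" by blast
  then have "\<bar>pairing (g j) T - pairing (g j) Q\<bar> \<le> c_rnd g r * d" if "j \<in> {1..r0} \<or> j \<in> {r0<..r}" for j
    using that \<open>r0 \<le> r\<close> by force
  then show ?thesis
    using Q unfolding window_set_def by (fastforce simp: abs_le_iff)
qed

text \<open>The intermediate law is the mixture of \<open>iid I (empirical N X)\<close> over the
  conditioned sample. It is compared with the conditional law through collisions and with
  \<open>iid I Q\<close> through the deviation event.\<close>

lemma tv_dist_cond_law_le:
  fixes P Q :: "'a::finite pmf"
  assumes "N > 0" "I \<subseteq> {1..N}" "\<delta> \<ge> 0"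
    and pos: "measure_pmf.prob (iid {1..N} P) {X. empirical N X \<in> S} > 0"
  shows "tv_dist (cond_law N I P S) (iid I Q)
    \<le> real (card I) * \<delta> + real (card I) * (real (card I) - 1) / (2 * real N)
      + measure_pmf.prob (iid {1..N} P) {X. empirical N X \<in> S \<and> tv_dist (empirical N X) Q > \<delta>}
        / measure_pmf.prob (iid {1..N} P) {X. empirical N X \<in> S}"
proof -
  let ?M = "iid {1..N} P" and ?E = "{X. empirical N X \<in> S}" and ?F = "{X. tv_dist (empirical N X) Q > \<delta>}"
  define \<mu> where "\<mu> = cond_pmf ?M ?E"
  have ne: "set_pmf ?M \<inter> ?E \<noteq> {}"
    using pos measure_Int_set_pmf[of ?M ?E] by (auto simp: Int_commute)
  have fin: "finite I" using assms(2) by (rule finite_subset) simp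
  have "tv_dist (bind_pmf \<mu> (\<lambda>X. iid I (empirical N X))) (bind_pmf \<mu> (\<lambda>_. iid I Q))
    \<le> real (card I) * \<delta> + measure_pmf.prob \<mu> ?F"
  proof (rule tv_dist_bind_le)
    fix X assume "X \<notin> ?F"
    then have "real (card I) * tv_dist (empirical N X) Q \<le> real (card I) * \<delta>"
      by (intro mult_left_mono) auto
    then show "tv_dist (iid I (empirical N X)) (iid I Q) \<le> real (card I) * \<delta>"
      using tv_dist_iid_le[OF fin, of "empirical N X" Q] by linarith
  qed (use assms in simp)
  moreover have "tv_dist (cond_law N I P S) (bind_pmf \<mu> (\<lambda>X. iid I (empirical N X)))
    \<le> real (card I) * (real (card I) - 1) / (2 * real N)"
    unfolding \<mu>_def by (rule tv_dist_cond_law_mixture[OF assms(1,2) ne])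
  moreover have "measure_pmf.prob \<mu> ?F = measure_pmf.prob ?M (?E \<inter> ?F) / measure_pmf.prob ?M ?E"
  proof -
    have "measure_pmf.prob \<mu> ?F = measure_pmf.prob \<mu> (?E \<inter> ?F)"
    proof -
      have "set_pmf \<mu> = set_pmf ?M \<inter> ?E"
        unfolding \<mu>_def by (rule set_cond_pmf[OF ne])
      then have "?F \<inter> set_pmf \<mu> = ?E \<inter> ?F \<inter> set_pmf \<mu>"
        by auto
      then show ?thesis by (metis measure_Int_set_pmf)
    qed
    also have "\<dots> = measure_pmf.prob ?M (?E \<inter> ?F) / measure_pmf.prob ?M ?E"
    \<comment> \<open>On \<open>?E\<close> the two mass functions are proportional, and each
      direction of the proportionality bounds one probability by the other.\<close>
    proof (rule antisym)
      let ?e = "measure_pmf.prob ?M ?E"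
      have pm: "pmf \<mu> X = 1 / ?e * pmf ?M X" if "X \<in> ?E" for X
        unfolding \<mu>_def pmf_cond[OF ne] using that by (simp only: if_True times_divide_eq_left mult_1_left)
      then have "pmf ?M X = ?e * pmf \<mu> X" if "X \<in> ?E" for X
        using pos that by simp
      then have "measure_pmf.prob ?M (?E \<inter> ?F) \<le> ?e * measure_pmf.prob \<mu> (?E \<inter> ?F)"
        by (intro prob_le_mult_prob) auto
      then show "measure_pmf.prob ?M (?E \<inter> ?F) / ?e \<le> measure_pmf.prob \<mu> (?E \<inter> ?F)"
        using pos by (simp only: pos_divide_le_eq mult.commute)
      have "measure_pmf.prob \<mu> (?E \<inter> ?F) \<le> 1 / ?e * measure_pmf.prob ?M (?E \<inter> ?F)"
        using pos pm by (intro prob_le_mult_prob) (auto simp del: One_nat_def)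
      then show "measure_pmf.prob \<mu> (?E \<inter> ?F) \<le> measure_pmf.prob ?M (?E \<inter> ?F) / ?e"
        by (simp only: times_divide_eq_left mult_1_left)
    qed
    finally show ?thesis .
  qed
  moreover have "?E \<inter> ?F = {X. empirical N X \<in> S \<and> tv_dist (empirical N X) Q > \<delta>}" by auto
  ultimately show ?thesis
    using tv_dist_triangle[of "cond_law N I P S" "iid I Q" "bind_pmf \<mu> (\<lambda>X. iid I (empirical N X))"]
    by simp
qed

lemma constraint_set_eq_window_set: "constraint_set g \<alpha> r0 r = window_set g \<alpha> r0 r 0"
  by (simp add: constraint_set_def window_set_def)

lemma window_set_mono:
  assumes "\<epsilon> \<le> \<epsilon>'"
  shows "window_set g \<alpha> r0 r \<epsilon> \<subseteq> window_set g \<alpha> r0 r \<epsilon>'"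
proof -
  have "\<bar>y\<bar> \<le> \<epsilon> \<Longrightarrow> \<bar>y\<bar> \<le> \<epsilon>'" "y \<ge> a - \<epsilon> \<Longrightarrow> y \<ge> a - \<epsilon>'" for y a :: real
    using assms by linarith+
  then show ?thesis by (auto simp: window_set_def)
qed

text \<open>The type is a rounding of \<open>Q'\<close>, whose smaller window leaves exactly the
  room that rounding needs. Its probability is measured against \<open>Q\<close>: the counts differ
  from \<open>N Q\<close> by 1 from rounding and by \<open>c\<close> from the distance of
  \<open>Q'\<close> to \<open>Q\<close>.\<close>

lemma prob_iid_window_set_ge:
  fixes P :: "'a::finite pmf"
  assumes "1 \<le> r" "r0 \<le> r" and P: "\<forall>x. pmf P x > 0" and "N > 0"
    and Q: "\<And>x. pmf Q x \<ge> q0" "q0 > 0" and L: "\<And>x. \<bar>ln (pmf P x / pmf Q x)\<bar> \<le> L"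
    and Q': "Q' \<in> window_set g \<alpha> r0 r (\<epsilon> - c_rnd g r / real N)" and close: "tv_dist Q' Q \<le> c / real N"
  shows "measure_pmf.prob (iid {1..N} P) {X. empirical N X \<in> window_set g \<alpha> r0 r \<epsilon>}
    \<ge> exp (- real N * rel_entropy Q P) * exp (- real CARD('a) * (1 + (1 + c) * L + (1 + c) / q0)) / (real N + 1) ^ CARD('a)"
proof -
  obtain n where n: "(\<Sum>x\<in>UNIV. n x) = N" "\<And>x. \<bar>real (n x) - real N * pmf Q' x\<bar> \<le> 1"
    using pmf_rounding by blast
  have "\<bar>real (n x) - real N * pmf Q x\<bar> \<le> 1 + c" for x
  proof -
    have "real N * \<bar>pmf Q' x - pmf Q x\<bar> \<le> real N * (c / real N)"
      using pmf_diff_le_tv_dist[of Q' x Q] close by (intro mult_left_mono) auto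
    then have "\<bar>real N * pmf Q' x - real N * pmf Q x\<bar> \<le> c"
      using \<open>N > 0\<close> by (simp add: abs_mult flip: right_diff_distrib)
    with n(2)[of x] show ?thesis by linarith
  qed
  then have "exp (- real N * rel_entropy Q P) * exp (- real CARD('a) * (1 + (1 + c) * L + (1 + c) / q0)) / (real N + 1) ^ CARD('a)
    \<le> measure_pmf.prob (iid {1..N} P) {X. \<forall>x. card {i\<in>{1..N}. X i = x} = n x}"
    using assms n(1) by (intro prob_iid_counts_ge_rel_entropy) auto
  also have "\<dots> \<le> measure_pmf.prob (iid {1..N} P) {X. empirical N X \<in> window_set g \<alpha> r0 r \<epsilon>}"
  proof (intro measure_pmf.finite_measure_mono subsetI CollectI)
    fix X assume "X \<in> {X. \<forall>x. card {i\<in>{1..N}. X i = x} = n x}"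
    then have "pmf (empirical N X) x = real (n x) / real N" for x
      using pmf_empirical[OF \<open>N > 0\<close>, of X x] by (simp only: mem_Collect_eq)
    then have "pmf (empirical N X) x - pmf Q' x = (real (n x) - real N * pmf Q' x) / real N" for x
      using \<open>N > 0\<close> by (simp add: diff_divide_distrib)
    then have "\<bar>pmf (empirical N X) x - pmf Q' x\<bar> = \<bar>real (n x) - real N * pmf Q' x\<bar> / real N" for x
      by simp
    then have "\<bar>pmf (empirical N X) x - pmf Q' x\<bar> \<le> 1 / real N" for x
      using n(2)[of x] by (simp add: divide_right_mono)
    from window_set_rounding[OF \<open>r0 \<le> r\<close> Q' this]
    show "empirical N X \<in> window_set g \<alpha> r0 r \<epsilon>" by simp
  qed simp
  finally show ?thesis .
qed

section \<open>The conditional law\<close>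

text \<open>Change of measure puts the factor \<open>exp (- N D(Q||P))\<close> into the numerator of
  the conditional deviation probability, and the type class puts the same factor into the
  denominator. Their cancellation leaves a polynomial in \<open>N\<close> times Hoeffding's
  exponential.\<close>

lemma tv_dist_cond_law_window_le:
  fixes P :: "'a::finite pmf" and g \<alpha> r0 r
  defines "Q \<equiv> \<lambda>\<epsilon>. I_projection P (window_set g \<alpha> r0 r \<epsilon>)"
  assumes r: "1 \<le> r" "r0 \<le> r" and P: "\<forall>x. pmf P x > 0"
    and Q: "\<And>x. pmf (Q \<epsilon>) x \<ge> q0" "q0 > 0" and L: "\<And>x. \<bar>ln (pmf P x / pmf (Q \<epsilon>) x)\<bar> \<le> L"
    and "N > 0" and ne: "window_set g \<alpha> r0 r (\<epsilon> - c_rnd g r / real N) \<noteq> {}"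
    and close: "tv_dist (Q (\<epsilon> - c_rnd g r / real N)) (Q \<epsilon>) \<le> c / real N"
    and I: "I \<subseteq> {1..N}" and "\<delta> \<ge> 0"
  shows "tv_dist (cond_law N I P (window_set g \<alpha> r0 r \<epsilon>)) (iid I (Q \<epsilon>))
    \<le> real (card I) * \<delta> + real (card I) * (real (card I) - 1) / (2 * real N)
      + 2 ^ CARD('a) * exp (real CARD('a) * (1 + (1 + c) * L + (1 + c) / q0))
        * (real N + 1) ^ CARD('a) * exp (- 2 * real N * \<delta>\<^sup>2)"
proof -
  let ?S = "window_set g \<alpha> r0 r \<epsilon>" and ?M = "iid {1..N} P"
  define D where "D = exp (- real N * rel_entropy (Q \<epsilon>) P)"
  define K where "K = real CARD('a) * (1 + (1 + c) * L + (1 + c) / q0)"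
  define T where "T = exp (- 2 * real N * \<delta>\<^sup>2)"
  define n where "n = (real N + 1) ^ CARD('a)"
  define p where "p = measure_pmf.prob ?M {X. empirical N X \<in> ?S}"
  have pos: "D > 0" "T > 0" "n > 0" by (simp_all add: D_def T_def n_def)
  have Q0: "\<forall>x. pmf (Q \<epsilon>) x > 0" using Q by (meson less_le_trans)
  have "Q (\<epsilon> - c_rnd g r / real N) \<in> window_set g \<alpha> r0 r (\<epsilon> - c_rnd g r / real N)"
    unfolding Q_def by (rule I_projection_window_set(1)[OF P ne])
  from prob_iid_window_set_ge[OF r P \<open>N > 0\<close> Q L this close]
  have lower: "p \<ge> D * exp (- K) / n"
    by (simp add: D_def K_def n_def p_def)
  moreover have "D * exp (- K) / n > 0" using pos by simp
  ultimately have p: "p > 0" by linarith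
  have "measure_pmf.prob ?M {X. empirical N X \<in> ?S \<and> tv_dist (empirical N X) (Q \<epsilon>) > \<delta>}
    \<le> D * measure_pmf.prob (iid {1..N} (Q \<epsilon>)) {X. empirical N X \<in> ?S \<and> tv_dist (empirical N X) (Q \<epsilon>) > \<delta>}"
    unfolding D_def
  proof (rule prob_iid_change_of_measure[OF P Q0 \<open>N > 0\<close>])
    fix X assume "X \<in> {X. empirical N X \<in> ?S \<and> tv_dist (empirical N X) (Q \<epsilon>) > \<delta>}"
    then show "rel_entropy (Q \<epsilon>) P \<le> pairing (\<lambda>x. ln (pmf (Q \<epsilon>) x / pmf P x)) (empirical N X)"
      unfolding Q_def using I_projection_pythagorean[OF P Q0[unfolded Q_def]] by blast
  qed
  also have "measure_pmf.prob (iid {1..N} (Q \<epsilon>)) {X. empirical N X \<in> ?S \<and> tv_dist (empirical N X) (Q \<epsilon>) > \<delta>}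
    \<le> measure_pmf.prob (iid {1..N} (Q \<epsilon>)) {X. tv_dist (empirical N X) (Q \<epsilon>) > \<delta>}"
    by (intro measure_pmf.finite_measure_mono) auto
  also have "\<dots> \<le> 2 ^ CARD('a) * T"
    unfolding T_def by (rule prob_iid_tv_dist_empirical_gt) fact+
  \<comment> \<open>The upper bound for the deviation event is divided by the lower bound for the
    window, where \<open>D\<close> cancels.\<close>
  finally have "measure_pmf.prob ?M {X. empirical N X \<in> ?S \<and> tv_dist (empirical N X) (Q \<epsilon>) > \<delta>} / p
    \<le> D * (2 ^ CARD('a) * T) / (D * exp (- K) / n)"
    using pos lower p by (intro frac_le) (auto simp: mult_left_mono)
  also have "\<dots> = 2 ^ CARD('a) * exp K * n * T"
    using pos by (simp add: exp_minus field_simps)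
  finally show ?thesis
    using tv_dist_cond_law_le[of N I \<delta> P ?S "Q \<epsilon>"] \<open>N > 0\<close> I \<open>\<delta> \<ge> 0\<close> p
    unfolding p_def K_def n_def T_def by linarith
qed

theorem theorem3:
  fixes P :: "'a::finite pmf"
    and g :: "nat \<Rightarrow> 'a \<Rightarrow> real" and \<alpha> :: "nat \<Rightarrow> real" and r0 r :: nat
  assumes "1 \<le> r" and "r0 \<le> r"
    and "\<forall>x. pmf P x > 0"
    and "constraint_set g \<alpha> r0 r \<noteq> {}"
    and "\<forall>x. pmf (I_projection P (constraint_set g \<alpha> r0 r)) x > 0"
  shows "\<exists>C::real. \<forall>C0::real. projection_lipschitz P g \<alpha> r0 r C0 \<longrightarrow>
    (\<forall>\<epsilon> :: nat \<Rightarrow> real.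
       antimono_on {1..} \<epsilon> \<and> \<epsilon> \<longlonglongrightarrow> 0 \<and>
       (\<forall>\<^sub>F N in sequentially. real N * \<epsilon> N > c_rnd g r) \<longrightarrow>
       (\<forall>\<^sub>F N in sequentially. \<forall>m I. I \<subseteq> {1..N} \<and> card I = m \<longrightarrow> (\<forall>\<delta>::real. \<delta> > 0 \<longrightarrow>
          tv_dist (cond_law N I P (window_set g \<alpha> r0 r (\<epsilon> N)))
                  (iid I (I_projection P (constraint_set g \<alpha> r0 r)))
          \<le> real m * \<delta> + real m * (real m - 1) / (2 * real N)
            + C * (real N + 1) ^ (2 * CARD('a)) * exp (- 2 * real N * \<delta>\<^sup>2)
            + C0 * real m * \<epsilon> N)))"
proof (cases "\<exists>C1. projection_lipschitz P g \<alpha> r0 r C1")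
  case False
  \<comment> \<open>Without any Lipschitz constant the premise fails for every
    \<open>C0\<close>.\<close>
  then show ?thesis by blast
next
  case True
  let ?S = "window_set g \<alpha> r0 r"
  define Q where "Q = (\<lambda>\<epsilon>. I_projection P (?S \<epsilon>))"
  \<comment> \<open>\<open>C\<close> is chosen before \<open>C0\<close>, so it is built from one fixed Lipschitz constant \<open>C1\<close>.\<close>
  from True obtain C1 \<eta> where \<eta>: "\<eta> > 0"
    and C1: "\<And>\<epsilon> \<epsilon>'. \<epsilon> \<in> {0..\<eta>} \<Longrightarrow> \<epsilon>' \<in> {0..\<eta>} \<Longrightarrow> tv_dist (Q \<epsilon>) (Q \<epsilon>') \<le> C1 * \<bar>\<epsilon> - \<epsilon>'\<bar>"
    unfolding projection_lipschitz_def Q_def by blast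
  have P: "\<forall>x. pmf P x > 0" by fact
  have Q0: "\<forall>x. pmf (Q 0) x > 0"
    using assms(5) by (simp add: Q_def constraint_set_eq_window_set)
  have crnd: "c_rnd g r \<ge> 0" by (rule c_rnd_nonneg) fact
  define p0 where "p0 = Min (range (pmf P))"
  \<comment> \<open>Half the least mass of the limiting projection: a projection within
    \<open>q0\<close> of it still has all masses at least \<open>q0\<close>.\<close>
  define q0 where "q0 = Min (range (pmf (Q 0))) / 2"
  have p0: "p0 > 0" "\<And>x. pmf P x \<ge> p0"
    using P by (auto simp: p0_def)
  have q0: "q0 > 0" "\<And>x. pmf (Q 0) x \<ge> 2 * q0"
    using Q0 by (auto simp: q0_def)
  define L where "L = - ln p0 - ln q0"
  \<comment> \<open>The windows of radius \<open>\<epsilon> N\<close> and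
    \<open>\<epsilon> N - c_rnd g r / N\<close> have projections at distance at most
    \<open>c / N\<close>.\<close>
  define c where "c = C1 * c_rnd g r"
  define C where "C = 2 ^ CARD('a) * exp (real CARD('a) * (1 + (1 + c) * L + (1 + c) / q0))"
  have "C \<ge> 0" by (simp add: C_def)
  have ne: "?S \<epsilon> \<noteq> {}" if "\<epsilon> \<ge> 0" for \<epsilon>
    using assms(4) window_set_mono[OF that] unfolding constraint_set_eq_window_set by blast
  show ?thesis
  proof (intro exI[of _ C] allI impI)
    fix C0 \<epsilon>
    assume "projection_lipschitz P g \<alpha> r0 r C0"
    then obtain \<eta>0 where \<eta>0: "\<eta>0 > 0"
      and C0: "\<And>\<epsilon> \<epsilon>'. \<epsilon> \<in> {0..\<eta>0} \<Longrightarrow> \<epsilon>' \<in> {0..\<eta>0} \<Longrightarrow> tv_dist (Q \<epsilon>) (Q \<epsilon>') \<le> C0 * \<bar>\<epsilon> - \<epsilon>'\<bar>"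
      unfolding projection_lipschitz_def Q_def by blast
    assume "antimono_on {1..} \<epsilon> \<and> \<epsilon> \<longlonglongrightarrow> 0 \<and> (\<forall>\<^sub>F N in sequentially. real N * \<epsilon> N > c_rnd g r)"
    then have lim: "\<epsilon> \<longlonglongrightarrow> 0" and large: "\<forall>\<^sub>F N in sequentially. real N * \<epsilon> N > c_rnd g r"
      by auto
    \<comment> \<open>This smallness makes the lower bound \<open>q0\<close> on the masses, and
      hence \<open>L\<close>, uniform in \<open>N\<close>.\<close>
    have "(\<lambda>N. C1 * \<epsilon> N) \<longlonglongrightarrow> C1 * 0" by (intro tendsto_intros lim)
    then have "\<forall>\<^sub>F N in sequentially. C1 * \<epsilon> N < q0"
      using q0 by (intro order_tendstoD(2)[where y = 0]) auto
    moreover have "\<forall>\<^sub>F N in sequentially. \<epsilon> N < \<eta>" "\<forall>\<^sub>F N in sequentially. \<epsilon> N < \<eta>0"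
      using order_tendstoD(2)[OF lim] \<eta> \<eta>0 by auto
    ultimately show "\<forall>\<^sub>F N in sequentially. \<forall>m I. I \<subseteq> {1..N} \<and> card I = m \<longrightarrow> (\<forall>\<delta>::real. \<delta> > 0 \<longrightarrow>
          tv_dist (cond_law N I P (?S (\<epsilon> N))) (iid I (I_projection P (constraint_set g \<alpha> r0 r)))
          \<le> real m * \<delta> + real m * (real m - 1) / (2 * real N)
            + C * (real N + 1) ^ (2 * CARD('a)) * exp (- 2 * real N * \<delta>\<^sup>2)
            + C0 * real m * \<epsilon> N)"
      using large eventually_gt_at_top[of 0]
    proof eventually_elim
      case (elim N)
      \<comment> \<open>The growth assumption makes \<open>e\<close> nonnegative, so its window
        contains the constraint set and the Lipschitz bound applies at \<open>e\<close>.\<close>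
      define e where "e = \<epsilon> N - c_rnd g r / real N"
      have e: "0 \<le> e" "e \<le> \<epsilon> N" "0 \<le> \<epsilon> N"
      proof -
        have "c_rnd g r / real N < \<epsilon> N" using elim by (simp add: field_simps)
        moreover have "0 \<le> c_rnd g r / real N" using crnd by simp
        ultimately show "0 \<le> e" "e \<le> \<epsilon> N" "0 \<le> \<epsilon> N" by (simp_all add: e_def)
      qed
      have close: "tv_dist (Q e) (Q (\<epsilon> N)) \<le> c / real N"
      proof -
        have "e \<in> {0..\<eta>}" "\<epsilon> N \<in> {0..\<eta>}" using e elim by auto
        from C1[OF this] show ?thesis using crnd by (simp add: e_def c_def)
      qed
      have Qq: "pmf (Q (\<epsilon> N)) x \<ge> q0" for x
      proof -
        have "\<bar>pmf (Q (\<epsilon> N)) x - pmf (Q 0) x\<bar> \<le> q0"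
          using pmf_diff_le_tv_dist[of "Q (\<epsilon> N)" x "Q 0"] C1[of "\<epsilon> N" 0] e elim \<eta> by simp
        with q0(2)[of x] show ?thesis by linarith
      qed
      have L: "\<bar>ln (pmf P x / pmf (Q (\<epsilon> N)) x)\<bar> \<le> L" for x
      proof -
        have "ln p0 \<le> ln (pmf P x)" "ln q0 \<le> ln (pmf (Q (\<epsilon> N)) x)"
          using p0 q0 Qq[of x] P by simp_all
        moreover have "ln (pmf P x) \<le> 0" "ln (pmf (Q (\<epsilon> N)) x) \<le> 0"
          using P[rule_format, of x] q0 Qq[of x] by (simp_all add: pmf_le_1 less_le_trans)
        moreover have "ln (pmf P x / pmf (Q (\<epsilon> N)) x) = ln (pmf P x) - ln (pmf (Q (\<epsilon> N)) x)"
          using P[rule_format, of x] q0 Qq[of x] by (simp add: ln_div)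
        ultimately show ?thesis by (simp add: L_def)
      qed
      show ?case
      proof (intro allI impI, elim conjE)
        fix m I and \<delta> :: real
        assume I: "I \<subseteq> {1..N}" and m: "card I = m" and "\<delta> > 0"
        have fin: "finite I" using I by (rule finite_subset) simp
        have "tv_dist (cond_law N I P (?S (\<epsilon> N))) (iid I (Q (\<epsilon> N)))
          \<le> real (card I) * \<delta> + real (card I) * (real (card I) - 1) / (2 * real N)
            + C * (real N + 1) ^ CARD('a) * exp (- 2 * real N * \<delta>\<^sup>2)"
          unfolding C_def Q_def
          by (rule tv_dist_cond_law_window_le)
            (use assms P Qq q0 L close ne e elim I \<open>\<delta> > 0\<close> in \<open>auto simp: Q_def e_def\<close>)
        \<comment> \<open>The argument gives the exponent \<open>CARD('a)\<close>; it is weakened to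
          the stated one.\<close>
        also have "C * (real N + 1) ^ CARD('a) * exp (- 2 * real N * \<delta>\<^sup>2)
          \<le> C * (real N + 1) ^ (2 * CARD('a)) * exp (- 2 * real N * \<delta>\<^sup>2)"
          using \<open>C \<ge> 0\<close> by (intro mult_right_mono mult_left_mono power_increasing) auto
        finally have 1: "tv_dist (cond_law N I P (?S (\<epsilon> N))) (iid I (Q (\<epsilon> N)))
          \<le> real (card I) * \<delta> + real (card I) * (real (card I) - 1) / (2 * real N)
            + C * (real N + 1) ^ (2 * CARD('a)) * exp (- 2 * real N * \<delta>\<^sup>2)" by simp
        \<comment> \<open>Only this passage from the window projection to the limiting one uses the
          given constant \<open>C0\<close>.\<close>
        have "tv_dist (iid I (Q (\<epsilon> N))) (iid I (Q 0)) \<le> real (card I) * tv_dist (Q (\<epsilon> N)) (Q 0)"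
          by (rule tv_dist_iid_le[OF fin])
        also have "\<dots> \<le> real (card I) * (C0 * \<epsilon> N)"
          using C0[of "\<epsilon> N" 0] e elim \<eta>0 by (intro mult_left_mono) auto
        finally have "tv_dist (iid I (Q (\<epsilon> N))) (iid I (Q 0)) \<le> C0 * real (card I) * \<epsilon> N"
          by (simp add: mult_ac)
        with 1 show "tv_dist (cond_law N I P (?S (\<epsilon> N))) (iid I (I_projection P (constraint_set g \<alpha> r0 r)))
          \<le> real m * \<delta> + real m * (real m - 1) / (2 * real N)
            + C * (real N + 1) ^ (2 * CARD('a)) * exp (- 2 * real N * \<delta>\<^sup>2)
            + C0 * real m * \<epsilon> N"
          using tv_dist_triangle[of "cond_law N I P (?S (\<epsilon> N))" "iid I (Q 0)" "iid I (Q (\<epsilon> N))"] m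
          unfolding constraint_set_eq_window_set Q_def m by linarith
      qed
    qed
  qed
qed

end
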